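(* Let $M=f^{-1}(\cos4\theta)\subset S^{2l-1}$ be an isoparametric hypersurface of OT--FKM type with multiplicities $(m_1,m_2)\in\{(1,2),(1,6),(2,5),(3,4)\}$. Then the principal distributions $\mathcal{D}_2$ and $\mathcal{D}_4$ are isomorphic as (real) vector bundles over $M$.
   Context: A symmetric Clifford system on $\mathbb{R}^{2l}$ is an $(m+1)$-tuple $\{P_0,\dots,P_m\}$ ($m\ge 1$) of symmetric orthogonal $2l\times 2l$ real matrices satisfying $P_iP_j+P_jP_i=2\delta_{ij}I$. Put $F(x)=|x|^4-2\sum_{i=0}^m\langle P_ix,x\rangle^2$ on $\mathbb{R}^{2l}$ and $f=F|_{S^{2l-1}}$, where $S^{2l-1}$ is the unit sphere. An isoparametric hypersurface of OT--FKM type is a level set $M=f^{-1}(\cos 4\theta)$ for a constant $\theta\in(0,\pi/4)$; it has dimension $2l-2$. Put $m_1:=m$ and $m_2:=l-m-1$. With respect to the unit normal $\xi=\nabla^S f/|\nabla^S f|$ ($\nabla^S$ the gradient on the sphere) and the shape operator $A_\xi$ given by $d\xi=-A_\xi$ on $TM$, $M$ has four distinct constant principal curvatures $\lambda_k=\cot(\theta+\frac{k-1}{4}\pi)$, $k=1,2,3,4$, with multiplicities $(m_1,m_2,m_1,m_2)$. The principal distribution $\mathcal{D}_k\subset TM$ is the eigenbundle of $A_\xi$ for the eigenvalue $\lambda_k$. *)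

theory Defs
  imports "HOL-Analysis.Analysis"
begin

definition clifford_system :: "nat \<Rightarrow> (nat \<Rightarrow> real^'n^'n) \<Rightarrow> bool" where
  "clifford_system m P \<longleftrightarrow> m \<ge> 1 \<and>
     (\<forall>i\<le>m. transpose (P i) = P i \<and> orthogonal_matrix (P i)) \<and>
     (\<forall>i\<le>m. \<forall>j\<le>m. P i ** P j + P j ** P i = (if i = j then 2 else 0) *\<^sub>R mat 1)"

definition fkm_poly :: "nat \<Rightarrow> (nat \<Rightarrow> real^'n^'n) \<Rightarrow> real^'n \<Rightarrow> real" where
  "fkm_poly m P x = norm x ^ 4 - 2 * (\<Sum>i\<le>m. ((P i *v x) \<bullet> x)\<^sup>2)"

definition fkm_hypersurface :: "nat \<Rightarrow> (nat \<Rightarrow> real^'n^'n) \<Rightarrow> real \<Rightarrow> (real^'n) set" where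
  "fkm_hypersurface m P \<theta> = {x \<in> sphere 0 1. fkm_poly m P x = cos (4 * \<theta>)}"

text \<open>The next two definitions are meant for an embedded submanifold \<open>S\<close> of a Euclidean space.
  There, curves that are only differentiable at \<open>0\<close> have the same velocities as smooth ones.\<close>

definition tangent_space :: "'a::real_normed_vector set \<Rightarrow> 'a \<Rightarrow> 'a set" where
  "tangent_space S x = {v. \<exists>\<gamma> \<epsilon>. \<epsilon> > 0 \<and> \<gamma> ` {-\<epsilon><..<\<epsilon>} \<subseteq> S \<and> \<gamma> 0 = x \<and>
     (\<gamma> has_vector_derivative v) (at 0)}"

text \<open>A derivative within \<open>S\<close> is determined only on tangent vectors; requiring the gradient itself
  to be tangent makes it unique. Only the values of \<open>f\<close> on \<open>S\<close> matter.\<close>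

definition gradient_on :: "'a::real_inner set \<Rightarrow> ('a \<Rightarrow> real) \<Rightarrow> 'a \<Rightarrow> 'a" where
  "gradient_on S f x = (THE v. v \<in> tangent_space S x \<and>
     (f has_derivative (\<lambda>h. v \<bullet> h)) (at x within S))"

definition fkm_normal :: "nat \<Rightarrow> (nat \<Rightarrow> real^'n^'n) \<Rightarrow> real^'n \<Rightarrow> real^'n" where
  "fkm_normal m P x =
     gradient_on (sphere 0 1) (fkm_poly m P) x /\<^sub>R norm (gradient_on (sphere 0 1) (fkm_poly m P) x)"

text \<open>For \<open>X\<close> tangent to \<open>M\<close> at \<open>x\<close>, this is the vector \<open>A X\<close> with \<open>d\<xi> = -A\<close> on the tangent spaces
  of \<open>M\<close>. On other vectors the value is unspecified, because the derivative is taken within \<open>M\<close>.\<close>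

definition shape_operator :: "'a::real_normed_vector set \<Rightarrow> ('a \<Rightarrow> 'a) \<Rightarrow> 'a \<Rightarrow> 'a \<Rightarrow> 'a" where
  "shape_operator M \<xi> x X = - frechet_derivative \<xi> (at x within M) X"

definition principal_curvature :: "real \<Rightarrow> nat \<Rightarrow> real" where
  "principal_curvature \<theta> k = cot (\<theta> + (real k - 1) / 4 * pi)"

definition principal_distribution ::
    "nat \<Rightarrow> (nat \<Rightarrow> real^'n^'n) \<Rightarrow> real \<Rightarrow> nat \<Rightarrow> real^'n \<Rightarrow> (real^'n) set" where
  "principal_distribution m P \<theta> k x =
     {X \<in> tangent_space (fkm_hypersurface m P \<theta>) x.
        shape_operator (fkm_hypersurface m P \<theta>) (fkm_normal m P) x X =
          principal_curvature \<theta> k *\<^sub>R X}"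

text \<open>A subbundle of the trivial bundle \<open>M \<times> V\<close> is given by its fibres \<open>D x \<subseteq> V\<close>, and its total space
  \<open>Sigma M D\<close> carries the subspace topology. An isomorphism over \<open>M\<close> is a homeomorphism of the total
  spaces that covers the identity of \<open>M\<close> and is linear on each fibre.\<close>

definition vector_bundle_isomorphic ::
    "'a::topological_space set \<Rightarrow> ('a \<Rightarrow> 'b::real_normed_vector set) \<Rightarrow>
       ('a \<Rightarrow> 'c::real_normed_vector set) \<Rightarrow> bool" where
  "vector_bundle_isomorphic M D E \<longleftrightarrow>
     (\<exists>\<Phi> \<Psi>. homeomorphism (Sigma M D) (Sigma M E) \<Phi> \<Psi> \<and>
        (\<forall>p\<in>Sigma M D. fst (\<Phi> p) = fst p) \<and>
        (\<forall>x\<in>M. \<forall>u\<in>D x. \<forall>v\<in>D x. \<forall>a b.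
           snd (\<Phi> (x, a *\<^sub>R u + b *\<^sub>R v)) = a *\<^sub>R snd (\<Phi> (x, u)) + b *\<^sub>R snd (\<Phi> (x, v))))"

end

theory Submission
  imports Defs
begin

text \<open>Put \<open>s = sin 2\<theta>\<close>. At a point \<open>x\<close> of the hypersurface the coefficient vector \<open>(\<langle>P\<^sub>i x, x\<rangle>)\<close> has norm \<open>s\<close>, so
  \<open>P\<^sub>x = \<Sum>i. (\<langle>P\<^sub>i x, x\<rangle> / s) P\<^sub>i\<close> is an involution. Let \<open>x = x\<^sub>+ + x\<^sub>-\<close> be the decomposition of \<open>x\<close> along its
  eigenspaces; both components are nonzero and depend continuously on \<open>x\<close>. The shape operator can be computed
  explicitly from the normal field, and its eigenspaces for the second and fourth principal curvature
  turn out to be the sets of all \<open>v\<close> that are orthogonal to \<open>x\<close> and to \<open>P\<^sub>0 x, \<dots>, P\<^sub>m x\<close> and satisfy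
  \<open>P\<^sub>x v = v\<close> and \<open>P\<^sub>x v = - v\<close>, respectively (\<open>principal_distribution_eq_eigen_fibre\<close>).

  For the four pairs of multiplicities \<open>l\<close> is \<open>4\<close> or \<open>8\<close> and \<open>m \<le> 3\<close>. In these cases the system is part of a
  Clifford system \<open>P\<^sub>0, \<dots>, P\<^sub>l\<close> on the same space (\<open>clifford_extension\<close>): in a suitable orthonormal basis it
  consists of the first members of the system given by quaternion or octonion multiplication. For the
  large system the Hopf identity \<open>\<Sum>j. \<langle>P\<^sub>j x, x\<rangle>\<^sup>2 = \<bar>x\<bar>\<^sup>4\<close> holds (\<open>full_quartic_identity\<close>), and its
  polarisation expands every \<open>v\<close> in one eigenspace of \<open>P\<^sub>x\<close> in the vectors \<open>P\<^sub>j u\<close>, for any \<open>u\<close> in the other one.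

  A vector \<open>v\<close> of the second principal space is orthogonal to the vectors \<open>P\<^sub>j x\<^sub>-\<close> with \<open>j \<le> m\<close>, hence
  \<open>v = \<Sum>j>m. a\<^sub>j P\<^sub>j x\<^sub>-\<close>. Orthogonality to \<open>x\<close> means \<open>\<Sum>j>m. a\<^sub>j \<langle>P\<^sub>j x\<^sub>-, x\<^sub>+\<rangle> = 0\<close>. Since the \<open>P\<^sub>j\<close> are symmetric,
  this condition on the coefficients does not change when \<open>x\<^sub>+\<close> and \<open>x\<^sub>-\<close> are exchanged, and so it also describes
  the fourth principal space in terms of the vectors \<open>P\<^sub>j x\<^sub>+\<close>. The map
  \<open>\<Sum>j>m. a\<^sub>j P\<^sub>j x\<^sub>- \<mapsto> \<Sum>j>m. a\<^sub>j P\<^sub>j x\<^sub>+\<close> is therefore the wanted isomorphism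
  (\<open>transfer_eigen_fibre\<close>, \<open>eigen_fibre_bundles_isomorphic\<close>).\<close>

section \<open>Clifford systems of operators\<close>

text \<open>Working with linear maps on a Euclidean space rather than with matrices allows a system to be
  enlarged by maps that are given on an orthonormal basis.\<close>

locale clifford_family =
  fixes m :: nat and A :: "nat \<Rightarrow> 'a::euclidean_space \<Rightarrow> 'a"
  assumes linear_A: "i \<le> m \<Longrightarrow> linear (A i)"
    and sym_A: "i \<le> m \<Longrightarrow> A i x \<bullet> y = x \<bullet> A i y"
    and anticomm_A: "i \<le> m \<Longrightarrow> j \<le> m \<Longrightarrow> A i (A j x) + A j (A i x) = (if i = j then 2 else 0) *\<^sub>R x"
begin

lemma A_A: "i \<le> m \<Longrightarrow> A i (A i x) = x"
  using anticomm_A[of i i x] by (simp flip: scaleR_2)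

lemma A_anti: "i \<le> m \<Longrightarrow> j \<le> m \<Longrightarrow> i \<noteq> j \<Longrightarrow> A i (A j x) = - A j (A i x)"
  using anticomm_A[of i j x] by (simp add: eq_neg_iff_add_eq_0)

lemma inner_A_A: "i \<le> m \<Longrightarrow> A i x \<bullet> A i y = x \<bullet> y"
  by (simp add: sym_A A_A)

lemma inner_A_A_swap:
  assumes "i \<le> m" "j \<le> m" "i \<noteq> j"
  shows "A i x \<bullet> A j y = - (A j x \<bullet> A i y)"
  using assms by (simp add: sym_A A_anti[OF assms, of y])

lemma inner_A_A_same:
  assumes "i \<le> m" "j \<le> m" "i \<noteq> j"
  shows "A i x \<bullet> A j x = 0"
  using inner_A_A_swap[OF assms, of x x] by (simp add: inner_commute)

definition comb :: "(nat \<Rightarrow> real) \<Rightarrow> 'a \<Rightarrow> 'a" where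
  "comb c x = (\<Sum>i\<le>m. c i *\<^sub>R A i x)"

lemma linear_comb: "linear (comb c)"
  unfolding comb_def
  by (intro linear_compose_sum linear_compose_scale_right ballI) (auto intro: linear_A)

lemma inner_comb_left: "comb c x \<bullet> y = (\<Sum>i\<le>m. c i * (A i x \<bullet> y))"
  by (simp add: comb_def inner_sum_left)

lemma comb_sym: "comb c x \<bullet> y = x \<bullet> comb c y"
  by (simp add: comb_def inner_sum_left inner_sum_right sym_A)

text \<open>The Clifford relations say that \<open>c \<mapsto> comb c\<close> turns the Euclidean inner product of coefficient vectors
  into anticommutators. So a unit vector \<open>c\<close> gives an involution, and orthogonal coefficient
  vectors give anticommuting maps.\<close>

lemma comb_anticomm: "comb c (comb d x) + comb d (comb c x) = (2 * (\<Sum>i\<le>m. c i * d i)) *\<^sub>R x"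
proof -
  have 1: "comb c (comb d x) = (\<Sum>i\<le>m. \<Sum>j\<le>m. (c i * d j) *\<^sub>R A i (A j x))" for c d
  proof -
    have "A i (\<Sum>j\<le>m. d j *\<^sub>R A j x) = (\<Sum>j\<le>m. d j *\<^sub>R A i (A j x))" if "i \<le> m" for i
      using linear_A[OF that] by (simp add: linear_sum linear_scale)
    then show ?thesis
      by (simp add: comb_def scaleR_sum_right)
  qed
  have 2: "comb d (comb c x) = (\<Sum>i\<le>m. \<Sum>j\<le>m. (c i * d j) *\<^sub>R A j (A i x))"
    by (subst 1, subst sum.swap) (simp add: mult.commute)
  have "comb c (comb d x) + comb d (comb c x)
      = (\<Sum>i\<le>m. \<Sum>j\<le>m. (c i * d j) *\<^sub>R (A i (A j x) + A j (A i x)))"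
    unfolding 1[of c d] 2 by (simp add: sum.distrib scaleR_add_right)
  also have "\<dots> = (\<Sum>i\<le>m. \<Sum>j\<le>m. if i = j then (2 * (c i * d i)) *\<^sub>R x else 0)"
    by (intro sum.cong refl) (auto simp: anticomm_A)
  also have "\<dots> = (2 * (\<Sum>i\<le>m. c i * d i)) *\<^sub>R x"
    by (simp add: sum.delta scaleR_sum_left sum_distrib_left)
  finally show ?thesis .
qed

lemma comb_comb: "comb c (comb c x) = (\<Sum>i\<le>m. (c i)\<^sup>2) *\<^sub>R x"
proof -
  have "2 *\<^sub>R comb c (comb c x) = 2 *\<^sub>R ((\<Sum>i\<le>m. (c i)\<^sup>2) *\<^sub>R x)"
    using comb_anticomm[of c c x] by (simp add: power2_eq_square scaleR_2)
  then show ?thesis unfolding scaleR_cancel_left by simp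
qed

lemma A_eq_comb: "i \<le> m \<Longrightarrow> A i x = comb (\<lambda>j. if j = i then 1 else 0) x"
  by (simp add: comb_def if_distrib[of "\<lambda>c. c *\<^sub>R _"] sum.delta cong: if_cong)

lemma comb_A: "i \<le> m \<Longrightarrow> comb c (A i x) = (2 * c i) *\<^sub>R x - A i (comb c x)"
  using comb_anticomm[of c "\<lambda>j. if j = i then 1 else 0" x]
  by (simp add: A_eq_comb[of i] if_distrib[of "(*) _"] eq_diff_eq cong: if_cong)

text \<open>On an eigenspace of \<open>comb p\<close> the compression of \<open>A i\<close> is a multiple of the identity, because
  the part of \<open>A i\<close> that is orthogonal to \<open>comb p\<close> maps the eigenspace into the opposite one.\<close>

lemma inner_A_eigenvector:
  assumes p: "comb p x = \<epsilon> *\<^sub>R x" and "comb p y = \<epsilon> *\<^sub>R y" and "i \<le> m"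
  shows "\<epsilon> * (A i x \<bullet> y) = p i * (x \<bullet> y)"
proof -
  have "\<epsilon> * (A i x \<bullet> y) = A i x \<bullet> comb p y"
    using assms by simp
  also have "\<dots> = comb p (A i x) \<bullet> y"
    by (simp add: comb_sym)
  also have "\<dots> = 2 * p i * (x \<bullet> y) - \<epsilon> * (A i x \<bullet> y)"
    using assms by (simp add: comb_A inner_diff_left linear_scale[OF linear_A])
  finally show ?thesis by simp
qed

lemma inner_eigenvectors_opposite:
  assumes "comb p x = \<epsilon> *\<^sub>R x" and "comb p y = (- \<epsilon>) *\<^sub>R y" and "\<epsilon> \<noteq> 0"
  shows "x \<bullet> y = 0"
proof -
  have "\<epsilon> * (x \<bullet> y) = comb p x \<bullet> y" using assms by simp
  also have "\<dots> = - \<epsilon> * (x \<bullet> y)" using assms(2) by (simp add: comb_sym)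
  finally have "\<epsilon> * (x \<bullet> y) = 0" by simp
  then show ?thesis using \<open>\<epsilon> \<noteq> 0\<close> by simp
qed

end

section \<open>Expansion in an orthonormal family\<close>

lemma orthonormal_family_expansion:
  fixes b :: "'i \<Rightarrow> 'a::euclidean_space"
  assumes "finite I" "card I = DIM('a)"
    and on: "\<And>i j. i \<in> I \<Longrightarrow> j \<in> I \<Longrightarrow> b i \<bullet> b j = (if i = j then 1 else 0)"
  shows "x = (\<Sum>i\<in>I. (x \<bullet> b i) *\<^sub>R b i)"
proof -
  have inj: "inj_on b I"
    by (rule inj_onI) (metis on zero_neq_one)
  have "pairwise orthogonal (b ` I)"
    by (auto simp: pairwise_def orthogonal_def on)
  moreover have "0 \<notin> b ` I"
    using on by force
  ultimately have "independent (b ` I)"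
    by (rule pairwise_orthogonal_independent)
  then have "span (b ` I) = UNIV"
    using card_ge_dim_independent[of "b ` I" UNIV] assms(2) inj by (auto simp: card_image)
  moreover have "(x - (\<Sum>i\<in>I. (x \<bullet> b i) *\<^sub>R b i)) \<bullet> b j = 0" if "j \<in> I" for j
    using that \<open>finite I\<close>
    by (simp add: inner_diff_left inner_sum_left on if_distrib[of "\<lambda>c. _ * c"] sum.delta cong: if_cong sum.cong)
  then have "orthogonal (x - (\<Sum>i\<in>I. (x \<bullet> b i) *\<^sub>R b i)) y" if "y \<in> span (b ` I)" for y
    using orthogonal_to_span[OF that] by (auto simp: orthogonal_def)
  ultimately have "orthogonal (x - (\<Sum>i\<in>I. (x \<bullet> b i) *\<^sub>R b i)) (x - (\<Sum>i\<in>I. (x \<bullet> b i) *\<^sub>R b i))"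
    by blast
  then show ?thesis
    by (simp add: orthogonal_self)
qed

lemma parseval_orthonormal_family:
  fixes b :: "'i \<Rightarrow> 'a::euclidean_space"
  assumes "finite I" "card I = DIM('a)"
    and "\<And>i j. i \<in> I \<Longrightarrow> j \<in> I \<Longrightarrow> b i \<bullet> b j = (if i = j then 1 else 0)"
  shows "x \<bullet> x = (\<Sum>i\<in>I. (x \<bullet> b i)\<^sup>2)"
proof -
  have "x \<bullet> x = x \<bullet> (\<Sum>i\<in>I. (x \<bullet> b i) *\<^sub>R b i)"
    using orthonormal_family_expansion[OF assms] by simp
  also have "\<dots> = (\<Sum>i\<in>I. (x \<bullet> b i)\<^sup>2)"
    by (simp add: inner_sum_right power2_eq_square)
  finally show ?thesis .
qed

section \<open>Systems of maximal size\<close>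

text \<open>Here \<open>m + 1\<close> maps act on a space of dimension \<open>2 * m\<close>, so that for a nonzero eigenvector \<open>u\<close> of \<open>A 0\<close> the
  vectors \<open>A 1 u, \<dots>, A m u\<close> fill the opposite eigenspace.\<close>

context clifford_family
begin

text \<open>For \<open>j \<ge> 1\<close> each \<open>A j\<close> exchanges the two eigenspaces of \<open>A 0\<close>. Hence the \<open>2 * m\<close> vectors \<open>A j u\<close> and \<open>A j u'\<close>
  are pairwise orthogonal and, after normalisation, form an orthonormal basis; the identity is Parseval's
  for \<open>u'\<close>, to which the vectors \<open>A j u'\<close> contribute nothing.\<close>

lemma full_product_identity:
  assumes dim: "DIM('a) = 2 * m"
    and u: "A 0 u = u" and u': "A 0 u' = - u'"
  shows "(\<Sum>j=1..m. (A j u \<bullet> u')\<^sup>2) = (u \<bullet> u) * (u' \<bullet> u')"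
proof (cases "u = 0 \<or> u' = 0")
  case True
  then show ?thesis by (auto simp: linear_0[OF linear_A])
next
  case False
  define v where "v k = (if k then u /\<^sub>R norm u else u' /\<^sub>R norm u')" for k
  define b where "b = (\<lambda>(j, k). A j (v k))"
  let ?I = "{1..m} \<times> (UNIV :: bool set)"
  have v1: "v k \<bullet> v k = 1" for k
    using False by (auto simp: v_def dot_square_norm power2_eq_square field_simps)
  have A0v: "A 0 (v k) = (if k then v k else - v k)" for k
    by (simp add: v_def u u' linear_scale[OF linear_A])
  have A0b: "A 0 (b (j, k)) = (if k then - b (j, k) else b (j, k))" if "j \<in> {1..m}" for j k
    using that A_anti[of 0 j "v k"] linear_neg[OF linear_A, of j] by (auto simp: b_def A0v)
  have bb: "b (j, True) \<bullet> b (i, False) = 0" if "j \<in> {1..m}" "i \<in> {1..m}" for i j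
    using sym_A[of 0 "b (j, True)" "b (i, False)"]
    by (simp add: A0b[OF that(1)] A0b[OF that(2)])
  have on: "b p \<bullet> b q = (if p = q then 1 else 0)" if "p \<in> ?I" "q \<in> ?I" for p q
  proof -
    obtain i k j l where [simp]: "p = (i, k)" "q = (j, l)" by fastforce
    show ?thesis
    proof (cases "k = l")
      case True
      with that v1 inner_A_A inner_A_A_same show ?thesis by (auto simp: b_def)
    next
      case False
      then have "b p \<bullet> b q = 0"
        using that bb[of i j] bb[of j i] by (cases k; cases l) (auto simp: inner_commute)
      then show ?thesis using False by auto
    qed
  qed
  have 0: "u' \<bullet> b (j, False) = 0" if "j \<in> {1..m}" for j
    using sym_A[of 0 u' "b (j, False)"] by (simp add: A0b[OF that] u')
  have 1: "(u' \<bullet> b (j, True))\<^sup>2 = (A j u \<bullet> u')\<^sup>2 / (u \<bullet> u)" if "j \<in> {1..m}" for j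
    using that by (simp add: b_def v_def linear_scale[OF linear_A] power_mult_distrib
        power2_norm_eq_inner inner_commute[of u'] divide_inverse power_inverse)
  have "u' \<bullet> u' = (\<Sum>p\<in>?I. (u' \<bullet> b p)\<^sup>2)"
    by (rule parseval_orthonormal_family[OF _ _ on]) (use dim in auto)
  also have "\<dots> = (\<Sum>j=1..m. \<Sum>k\<in>UNIV. (u' \<bullet> b (j, k))\<^sup>2)"
    by (simp add: sum.cartesian_product)
  also have "\<dots> = (\<Sum>j=1..m. (A j u \<bullet> u')\<^sup>2 / (u \<bullet> u))"
    by (intro sum.cong refl) (simp add: UNIV_bool 0 1)
  finally show ?thesis
    using False by (simp add: sum_divide_distrib[symmetric])
qed

text \<open>The map \<open>x \<mapsto> (A j x \<bullet> x)\<close> is a Hopf map: in terms of the components \<open>u\<close> and \<open>u'\<close> of \<open>x\<close> in the eigenspaces of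
  \<open>A 0\<close>, its coordinates are \<open>u \<bullet> u - u' \<bullet> u'\<close> and \<open>2 * (A j u \<bullet> u')\<close>.\<close>

lemma full_quartic_identity:
  assumes "DIM('a) = 2 * m"
  shows "(\<Sum>j\<le>m. (A j x \<bullet> x)\<^sup>2) = (x \<bullet> x)\<^sup>2"
proof -
  define u where "u = (1/2) *\<^sub>R (x + A 0 x)"
  define u' where "u' = (1/2) *\<^sub>R (x - A 0 x)"
  note lin = linear_scale[OF linear_A] linear_add[OF linear_A] linear_diff[OF linear_A]
  have u: "A 0 u = u" and u': "A 0 u' = - u'"
    by (simp_all add: u_def u'_def lin A_A add.commute algebra_simps)
  have x: "x = u + u'"
    by (simp add: u_def u'_def algebra_simps flip: scaleR_add_left)
  have uu': "u \<bullet> u' = 0"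
    using sym_A[of 0 u u'] by (simp add: u u')
  have 0: "A 0 x \<bullet> x = u \<bullet> u - u' \<bullet> u'"
    unfolding x by (simp add: lin u u' inner_simps uu' inner_commute[of u' u])
  have j: "A j x \<bullet> x = 2 * (A j u \<bullet> u')" if "j \<in> {1..m}" for j
  proof -
    have "A j u \<bullet> u = 0"
      using sym_A[of 0 "A j u" u] A_anti[of 0 j u] that by (simp add: u)
    moreover have "A j u' \<bullet> u' = 0"
      using sym_A[of 0 "A j u'" u'] A_anti[of 0 j u'] that
        linear_neg[OF linear_A, of j] by (simp add: u')
    moreover have "A j u' \<bullet> u = A j u \<bullet> u'"
      using sym_A[of j u' u] that by (simp add: inner_commute)
    ultimately show ?thesis
      unfolding x using that by (simp add: lin inner_simps)
  qed
  have "(\<Sum>j\<le>m. (A j x \<bullet> x)\<^sup>2) = (A 0 x \<bullet> x)\<^sup>2 + (\<Sum>j=1..m. (A j x \<bullet> x)\<^sup>2)"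
    by (simp add: atMost_atLeast0 sum.atLeast_Suc_atMost)
  also have "\<dots> = (u \<bullet> u - u' \<bullet> u')\<^sup>2 + 4 * ((u \<bullet> u) * (u' \<bullet> u'))"
    by (simp add: 0 j power_mult_distrib full_product_identity[OF assms u u', symmetric] sum_distrib_left)
  also have "\<dots> = (x \<bullet> x)\<^sup>2"
    unfolding x by (simp add: inner_simps uu' inner_commute[of u' u] power2_eq_square algebra_simps)
  finally show ?thesis .
qed

text \<open>This extends the observation about \<open>A 0\<close> to every involution \<open>comb p\<close>. The quartic identity at \<open>u + v\<close> yields
  \<open>\<Sum>j. (v \<bullet> A j u)\<^sup>2 = (u \<bullet> u) * (v \<bullet> v)\<close>, which is the case of equality in Bessel's inequality for the
  orthogonal vectors \<open>A j u\<close>.\<close>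

lemma full_expansion:
  assumes dim: "DIM('a) = 2 * m" and p: "(\<Sum>i\<le>m. (p i)\<^sup>2) = 1" and \<epsilon>: "\<epsilon>\<^sup>2 = 1"
    and u: "comb p u = (- \<epsilon>) *\<^sub>R u" and v: "comb p v = \<epsilon> *\<^sub>R v"
  shows "(u \<bullet> u) *\<^sub>R v = (\<Sum>j\<le>m. (v \<bullet> A j u) *\<^sub>R A j u)"
proof -
  have \<epsilon>\<epsilon>: "\<epsilon> * \<epsilon> = 1" and "\<epsilon> \<noteq> 0" using \<epsilon> by (auto simp: power2_eq_square)
  have vu: "v \<bullet> u = 0" and uv: "u \<bullet> v = 0"
    using inner_eigenvectors_opposite[OF v u \<open>\<epsilon> \<noteq> 0\<close>] by (auto simp: inner_commute)
  have Avv: "A j v \<bullet> v = \<epsilon> * p j * (v \<bullet> v)" if "j \<le> m" for j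
  proof -
    have "\<epsilon> * (\<epsilon> * (A j v \<bullet> v)) = \<epsilon> * (p j * (v \<bullet> v))"
      using inner_A_eigenvector[OF v v that] by simp
    then show ?thesis by (simp add: \<epsilon>\<epsilon> flip: mult.assoc)
  qed
  have Auu: "A j u \<bullet> u = - \<epsilon> * p j * (u \<bullet> u)" if "j \<le> m" for j
  proof -
    have "\<epsilon> * ((- \<epsilon>) * (A j u \<bullet> u)) = \<epsilon> * (p j * (u \<bullet> u))"
      using inner_A_eigenvector[OF u u that] by simp
    then show ?thesis by (simp add: \<epsilon>\<epsilon> flip: mult.assoc)
  qed
  have j: "(A j (u + v) \<bullet> (u + v))\<^sup>2 = (p j)\<^sup>2 * (v \<bullet> v - u \<bullet> u)\<^sup>2
      + 4 * (v \<bullet> A j u)\<^sup>2 + 4 * \<epsilon> * (v \<bullet> v - u \<bullet> u) * (p j * (A j u \<bullet> v))" if "j \<le> m" for j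
  proof -
    have "A j v \<bullet> u = v \<bullet> A j u" "A j u \<bullet> v = v \<bullet> A j u"
      using sym_A[of j v u] that by (simp_all add: inner_commute)
    then have "A j (u + v) \<bullet> (u + v) = \<epsilon> * (p j * (v \<bullet> v - u \<bullet> u)) + 2 * (v \<bullet> A j u)"
      using that by (simp add: linear_add[OF linear_A] inner_add_left inner_add_right Avv Auu algebra_simps)
    then have "(A j (u + v) \<bullet> (u + v))\<^sup>2 = (\<epsilon> * (p j * (v \<bullet> v - u \<bullet> u)) + 2 * (v \<bullet> A j u))\<^sup>2"
      by simp
    also have "\<dots> = \<epsilon>\<^sup>2 * ((p j)\<^sup>2 * (v \<bullet> v - u \<bullet> u)\<^sup>2)
        + 4 * (v \<bullet> A j u)\<^sup>2 + 4 * \<epsilon> * (v \<bullet> v - u \<bullet> u) * (p j * (v \<bullet> A j u))"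
      by (simp add: power2_eq_square algebra_simps)
    finally show ?thesis
      using \<epsilon> by (simp add: inner_commute)
  qed
  have "(\<Sum>j\<le>m. (A j (u + v) \<bullet> (u + v))\<^sup>2) = (v \<bullet> v - u \<bullet> u)\<^sup>2
      + 4 * (\<Sum>j\<le>m. (v \<bullet> A j u)\<^sup>2) + 4 * \<epsilon> * (v \<bullet> v - u \<bullet> u) * (comb p u \<bullet> v)"
  proof -
    have "(\<Sum>j\<le>m. (A j (u + v) \<bullet> (u + v))\<^sup>2) = (\<Sum>j\<le>m. (p j)\<^sup>2) * (v \<bullet> v - u \<bullet> u)\<^sup>2
      + 4 * (\<Sum>j\<le>m. (v \<bullet> A j u)\<^sup>2) + 4 * \<epsilon> * (v \<bullet> v - u \<bullet> u) * (\<Sum>j\<le>m. p j * (A j u \<bullet> v))"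
      unfolding sum_distrib_left sum_distrib_right sum.distrib[symmetric]
      by (intro sum.cong refl) (rule j, simp)
    then show ?thesis by (simp add: p inner_comb_left)
  qed
  then have "4 * (\<Sum>j\<le>m. (v \<bullet> A j u)\<^sup>2) = (u \<bullet> u + v \<bullet> v)\<^sup>2 - (v \<bullet> v - u \<bullet> u)\<^sup>2"
    using full_quartic_identity[OF dim, of "u + v"] by (simp add: u uv vu inner_simps)
  also have "\<dots> = 4 * ((u \<bullet> u) * (v \<bullet> v))"
    by (simp add: power2_eq_square algebra_simps)
  finally have S: "(\<Sum>j\<le>m. (v \<bullet> A j u)\<^sup>2) = (u \<bullet> u) * (v \<bullet> v)" by simp
  define w where "w = (\<Sum>j\<le>m. (v \<bullet> A j u) *\<^sub>R A j u)"
  have wv: "w \<bullet> v = (u \<bullet> u) * (v \<bullet> v)"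
    by (simp add: w_def inner_sum_left S[symmetric] power2_eq_square inner_commute[of "A _ _" v])
  have wA: "w \<bullet> A j u = (v \<bullet> A j u) * (u \<bullet> u)" if "j \<le> m" for j
  proof -
    have "w \<bullet> A j u = (\<Sum>i\<le>m. (v \<bullet> A i u) * (if i = j then u \<bullet> u else 0))"
      using that by (auto simp: w_def inner_sum_left inner_A_A inner_A_A_same intro!: sum.cong)
    then show ?thesis using that by (simp add: if_distrib[of "(*) _"] cong: if_cong)
  qed
  have "w \<bullet> w = (\<Sum>j\<le>m. (v \<bullet> A j u) * (w \<bullet> A j u))"
    by (subst (2) w_def) (simp add: inner_sum_right)
  also have "\<dots> = (u \<bullet> u) * ((u \<bullet> u) * (v \<bullet> v))"
    unfolding S[symmetric] sum_distrib_left
    by (intro sum.cong refl) (simp add: wA power2_eq_square)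
  finally have ww: "w \<bullet> w = (u \<bullet> u) * ((u \<bullet> u) * (v \<bullet> v))" .
  have "((u \<bullet> u) *\<^sub>R v - w) \<bullet> ((u \<bullet> u) *\<^sub>R v - w) = 0"
    by (simp add: inner_simps wv ww inner_commute[of v w] algebra_simps)
  then show ?thesis by (simp add: w_def)
qed

end

section \<open>The bundle isomorphism\<close>

text \<open>If \<open>s\<close> is the norm of the coefficient vector \<open>(A i x \<bullet> x)\<close>, this is the involution \<open>P\<^sub>x\<close> in the span of the system
  that points in the direction of that vector.\<close>

definition pole :: "nat \<Rightarrow> (nat \<Rightarrow> 'a::euclidean_space \<Rightarrow> 'a) \<Rightarrow> real \<Rightarrow> 'a \<Rightarrow> 'a \<Rightarrow> 'a" where
  "pole n A s x v = (\<Sum>i\<le>n. (A i x \<bullet> x / s) *\<^sub>R A i v)"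

text \<open>On an OT--FKM hypersurface with \<open>s = sin (2 * \<theta>)\<close> these are the principal spaces for the second
  (\<open>\<epsilon> = 1\<close>) and fourth (\<open>\<epsilon> = - 1\<close>) principal curvature.\<close>

definition eigen_fibre :: "nat \<Rightarrow> (nat \<Rightarrow> 'a::euclidean_space \<Rightarrow> 'a) \<Rightarrow> real \<Rightarrow> real \<Rightarrow> 'a \<Rightarrow> 'a set" where
  "eigen_fibre n A s \<epsilon> x = {v. v \<bullet> x = 0 \<and> (\<forall>i\<le>n. A i x \<bullet> v = 0) \<and> pole n A s x v = \<epsilon> *\<^sub>R v}"

text \<open>For \<open>\<epsilon> = 1\<close> and \<open>\<epsilon> = - 1\<close> these are the components of \<open>x\<close> in the two eigenspaces of \<open>P\<^sub>x\<close>.\<close>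

definition eigenpart :: "nat \<Rightarrow> (nat \<Rightarrow> 'a::euclidean_space \<Rightarrow> 'a) \<Rightarrow> real \<Rightarrow> real \<Rightarrow> 'a \<Rightarrow> 'a" where
  "eigenpart n A s \<epsilon> x = (1/2) *\<^sub>R (x + \<epsilon> *\<^sub>R pole n A s x x)"

context clifford_family
begin

lemma comb_eigenpart:
  assumes "(\<Sum>i\<le>m. (p i)\<^sup>2) = 1" "\<epsilon>\<^sup>2 = 1"
  shows "comb p ((1/2) *\<^sub>R (x + \<epsilon> *\<^sub>R comb p x)) = \<epsilon> *\<^sub>R ((1/2) *\<^sub>R (x + \<epsilon> *\<^sub>R comb p x))"
proof -
  have "\<epsilon> * \<epsilon> = 1"
    using assms(2) by (simp add: power2_eq_square)
  then show ?thesis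
    by (simp add: linear_scale[OF linear_comb] linear_add[OF linear_comb] comb_comb assms(1)
        scaleR_add_right add.commute)
qed

lemma inner_eigenpart:
  assumes "(\<Sum>i\<le>m. (p i)\<^sup>2) = 1" "\<epsilon>\<^sup>2 = 1"
  shows "((1/2) *\<^sub>R (x + \<epsilon> *\<^sub>R comb p x)) \<bullet> ((1/2) *\<^sub>R (x + \<epsilon> *\<^sub>R comb p x))
    = (x \<bullet> x + \<epsilon> * (comb p x \<bullet> x)) / 2"
proof -
  have "comb p x \<bullet> comb p x = x \<bullet> x"
    by (simp add: comb_sym comb_comb assms)
  then show ?thesis
    using assms(2) by (simp add: inner_add_left inner_add_right inner_commute[of x "comb p x"]
        power2_eq_square field_simps)
qed

text \<open>The point is \<open>x = u + w\<close>, split along the eigenspaces of \<open>comb p\<close>. A vector \<open>v\<close> of the fibre is orthogonal to \<open>A i u\<close>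
  for \<open>i \<le> n\<close>, so its expansion only involves \<open>A j u\<close> with \<open>n < j\<close>: the maps by which the small system
  was enlarged. They anticommute with \<open>comb p\<close>, hence replacing \<open>A j u\<close> by \<open>A j w\<close> leads to the opposite
  eigenspace. The condition \<open>v \<bullet> w = 0\<close> becomes \<open>v' \<bullet> u = 0\<close> because
  \<open>A j u \<bullet> w = A j w \<bullet> u\<close>. The coefficients of \<open>v'\<close> are those of \<open>v\<close>, so going back with \<open>u\<close> and \<open>w\<close>
  exchanged restores \<open>v\<close>.\<close>

lemma transfer_eigen_fibre:
  assumes dim: "DIM('a) = 2 * m" and p: "(\<Sum>i\<le>m. (p i)\<^sup>2) = 1" and \<epsilon>: "\<epsilon>\<^sup>2 = 1"
    and supp: "\<And>i. n < i \<Longrightarrow> i \<le> m \<Longrightarrow> p i = 0" and "n \<le> m"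
    and u: "comb p u = (- \<epsilon>) *\<^sub>R u" and w: "comb p w = \<epsilon> *\<^sub>R w"
    and "u \<noteq> 0" "w \<noteq> 0"
    and v: "comb p v = \<epsilon> *\<^sub>R v" and vx: "v \<bullet> (u + w) = 0" and vA: "\<And>i. i \<le> n \<Longrightarrow> A i (u + w) \<bullet> v = 0"
  defines "v' \<equiv> \<Sum>j\<in>{n<..m}. (v \<bullet> A j u / (u \<bullet> u)) *\<^sub>R A j w"
  shows "comb p v' = (- \<epsilon>) *\<^sub>R v'" and "v' \<bullet> (u + w) = 0" and "i \<le> n \<Longrightarrow> A i (u + w) \<bullet> v' = 0"
    and "(\<Sum>j\<in>{n<..m}. (v' \<bullet> A j w / (w \<bullet> w)) *\<^sub>R A j u) = v"
proof -
  have "\<epsilon> \<noteq> 0" using \<epsilon> by auto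
  have vu: "v \<bullet> u = 0"
    by (rule inner_eigenvectors_opposite[OF v u \<open>\<epsilon> \<noteq> 0\<close>])
  have vw: "v \<bullet> w = 0"
    using vx vu by (simp add: inner_add_right)
  have Av: "A i u \<bullet> v = 0" if "i \<le> n" for i
  proof -
    have "\<epsilon> * (A i w \<bullet> v) = 0"
      using inner_A_eigenvector[OF w v, of i] that \<open>n \<le> m\<close> vw by (simp add: inner_commute)
    then show ?thesis
      using vA[OF that] that \<open>n \<le> m\<close> \<open>\<epsilon> \<noteq> 0\<close>
      by (simp add: linear_add[OF linear_A] inner_add_left)
  qed
  define a where "a j = v \<bullet> A j u / (u \<bullet> u)" for j
  have v': "v' = (\<Sum>j\<in>{n<..m}. a j *\<^sub>R A j w)"
    by (simp add: v'_def a_def)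
  have "(u \<bullet> u) *\<^sub>R v = (\<Sum>j\<le>m. (v \<bullet> A j u) *\<^sub>R A j u)"
    by (rule full_expansion[OF dim p \<epsilon> u v])
  also have "\<dots> = (\<Sum>j\<in>{n<..m}. (v \<bullet> A j u) *\<^sub>R A j u)"
    using Av by (intro sum.mono_neutral_right) (auto simp: inner_commute[of v])
  also have "\<dots> = (u \<bullet> u) *\<^sub>R (\<Sum>j\<in>{n<..m}. a j *\<^sub>R A j u)"
    using \<open>u \<noteq> 0\<close> by (simp add: a_def scaleR_sum_right)
  finally have v_eq: "v = (\<Sum>j\<in>{n<..m}. a j *\<^sub>R A j u)"
    using \<open>u \<noteq> 0\<close> by simp
  have "comb p (A j w) = - \<epsilon> *\<^sub>R A j w" if "j \<in> {n<..m}" for j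
    using that by (simp add: comb_A supp w linear_scale[OF linear_A])
  then have "comb p v' = (\<Sum>j\<in>{n<..m}. a j *\<^sub>R (- \<epsilon> *\<^sub>R A j w))"
    unfolding v' linear_sum[OF linear_comb] linear_scale[OF linear_comb]
    by (intro sum.cong refl) simp
  then show v'_eigen: "comb p v' = (- \<epsilon>) *\<^sub>R v'"
    by (simp add: v' scaleR_sum_right mult.commute sum_negf)
  have wv': "w \<bullet> v' = 0"
    by (rule inner_eigenvectors_opposite[OF w v'_eigen \<open>\<epsilon> \<noteq> 0\<close>])
  have "v' \<bullet> u = (\<Sum>j\<in>{n<..m}. a j * (A j w \<bullet> u))"
    by (simp add: v' inner_sum_left)
  also have "\<dots> = (\<Sum>j\<in>{n<..m}. a j * (A j u \<bullet> w))"
    by (intro sum.cong refl) (metis sym_A inner_commute greaterThanAtMost_iff)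
  also have "\<dots> = v \<bullet> w"
    by (simp add: v_eq inner_sum_left)
  finally have v'u: "v' \<bullet> u = 0" using vw by simp
  with wv' show "v' \<bullet> (u + w) = 0"
    by (simp add: inner_add_right inner_commute)
  show "A i (u + w) \<bullet> v' = 0" if "i \<le> n"
  proof -
    have i: "i \<le> m" using that \<open>n \<le> m\<close> by simp
    have "\<epsilon> * (A i u \<bullet> v') = 0"
      using inner_A_eigenvector[OF u v'_eigen i] v'u by (simp add: inner_commute)
    moreover have "A i w \<bullet> v' = 0"
      using that i by (auto simp: v' inner_sum_right inner_A_A_same intro!: sum.neutral)
    ultimately show ?thesis
      using \<open>\<epsilon> \<noteq> 0\<close> i by (simp add: linear_add[OF linear_A] inner_add_left)
  qed
  have "v' \<bullet> A j w / (w \<bullet> w) = a j" if "j \<in> {n<..m}" for j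
  proof -
    have "v' \<bullet> A j w = (\<Sum>i\<in>{n<..m}. a i * (if i = j then w \<bullet> w else 0))"
      using that by (auto simp: v' inner_sum_left inner_A_A inner_A_A_same intro!: sum.cong)
    then show ?thesis
      using that \<open>w \<noteq> 0\<close> by (simp add: if_distrib[of "(*) _"] cong: if_cong)
  qed
  then show "(\<Sum>j\<in>{n<..m}. (v' \<bullet> A j w / (w \<bullet> w)) *\<^sub>R A j u) = v"
    by (simp add: v_eq)
qed

lemma continuous_on_A [continuous_intros]:
  "i \<le> m \<Longrightarrow> continuous_on S f \<Longrightarrow> continuous_on S (\<lambda>x. A i (f x))"
  by (simp add: continuous_on_compose2[OF linear_continuous_on[of "A i" UNIV]]
      linear_conv_bounded_linear[symmetric] linear_A)

lemma continuous_on_eigenpart [continuous_intros]: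
  assumes "n \<le> m" "continuous_on S f"
  shows "continuous_on S (\<lambda>x. eigenpart n A s \<epsilon> (f x))"
  unfolding eigenpart_def pole_def divide_inverse
  by (intro continuous_intros) (use assms in auto)

text \<open>The fibrewise transfer depends continuously on the point because
  the components of \<open>x\<close> in the eigenspaces of \<open>P\<^sub>x\<close> are polynomial in \<open>x\<close> and have the constant squared
  norms \<open>(1 \<plusminus> s) / 2 > 0\<close>.\<close>

theorem eigen_fibre_bundles_isomorphic:
  assumes dim: "DIM('a) = 2 * m" and "n \<le> m" and s: "0 < s" "s < 1"
    and M: "\<And>x. x \<in> M \<Longrightarrow> x \<bullet> x = 1" "\<And>x. x \<in> M \<Longrightarrow> (\<Sum>i\<le>n. (A i x \<bullet> x)\<^sup>2) = s\<^sup>2"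
  shows "vector_bundle_isomorphic M (eigen_fibre n A s 1) (eigen_fibre n A s (- 1))"
proof -
  let ?e = "eigenpart n A s"
  define T where "T \<epsilon> x v =
    (\<Sum>j\<in>{n<..m}. (v \<bullet> A j (?e (- \<epsilon>) x) / (?e (- \<epsilon>) x \<bullet> ?e (- \<epsilon>) x)) *\<^sub>R A j (?e \<epsilon> x))" for \<epsilon> x v
  have nz: "?e \<epsilon> x \<bullet> ?e \<epsilon> x > 0"
    and T: "v \<in> eigen_fibre n A s \<epsilon> x \<Longrightarrow> T \<epsilon> x v \<in> eigen_fibre n A s (- \<epsilon>) x"
    and TT: "v \<in> eigen_fibre n A s \<epsilon> x \<Longrightarrow> T (- \<epsilon>) x (T \<epsilon> x v) = v"
    if "x \<in> M" and \<epsilon>: "\<epsilon> \<in> {1, - 1}" for \<epsilon> x v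
  proof -
    define p where "p i = (if i \<le> n then A i x \<bullet> x / s else 0)" for i
    have restr: "(\<Sum>i\<le>m. if i \<le> n then f i else 0) = (\<Sum>i\<le>n. f i)" for f :: "nat \<Rightarrow> 'b::comm_monoid_add"
      using \<open>n \<le> m\<close> by (intro sum.mono_neutral_cong_right) auto
    have pole: "pole n A s x y = comb p y" for y
      by (simp add: pole_def comb_def p_def if_distrib[of "\<lambda>c. c *\<^sub>R _"] restr cong: if_cong)
    have "(\<Sum>i\<le>m. (p i)\<^sup>2) = (\<Sum>i\<le>n. (A i x \<bullet> x)\<^sup>2) / s\<^sup>2"
      by (simp add: p_def if_distrib[of "\<lambda>c. c\<^sup>2"] restr power_divide sum_divide_distrib cong: if_cong)
    then have p: "(\<Sum>i\<le>m. (p i)\<^sup>2) = 1"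
      using M that s by simp
    have "comb p x \<bullet> x = (\<Sum>i\<le>n. (A i x \<bullet> x)\<^sup>2) / s"
      by (simp add: pole[symmetric] pole_def inner_sum_left power2_eq_square sum_divide_distrib)
    then have px: "comb p x \<bullet> x = s"
      using M that s by (simp add: power2_eq_square)
    have e: "?e \<delta> x = (1/2) *\<^sub>R (x + \<delta> *\<^sub>R comb p x)" for \<delta>
      by (simp add: eigenpart_def pole)
    have e_pos: "?e \<delta> x \<bullet> ?e \<delta> x > 0" and e_eigen: "comb p (?e \<delta> x) = \<delta> *\<^sub>R ?e \<delta> x" if "\<delta> \<in> {1, - 1}" for \<delta>
    proof -
      have "\<delta>\<^sup>2 = 1" using that by auto
      then show "comb p (?e \<delta> x) = \<delta> *\<^sub>R ?e \<delta> x"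
        unfolding e using comb_eigenpart[OF p] by blast
      have "?e \<delta> x \<bullet> ?e \<delta> x = (1 + \<delta> * s) / 2"
        unfolding e inner_eigenpart[OF p \<open>\<delta>\<^sup>2 = 1\<close>] using M \<open>x \<in> M\<close> px by simp
      also have "\<dots> > 0" using that s by auto
      finally show "?e \<delta> x \<bullet> ?e \<delta> x > 0" .
    qed
    have x: "?e (- \<epsilon>) x + ?e \<epsilon> x = x"
      by (simp add: e algebra_simps flip: scaleR_add_left)
    have fibre: "v \<in> eigen_fibre n A s \<delta> x \<longleftrightarrow>
        v \<bullet> x = 0 \<and> (\<forall>i\<le>n. A i x \<bullet> v = 0) \<and> comb p v = \<delta> *\<^sub>R v" for \<delta> v
      by (simp add: eigen_fibre_def pole)
    have eps: "\<epsilon>\<^sup>2 = 1" "- \<epsilon> \<in> {1, - 1}" using \<epsilon> by auto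
    have ne: "?e \<epsilon> x \<noteq> 0" "?e (- \<epsilon>) x \<noteq> 0"
      using e_pos[OF \<epsilon>] e_pos[OF eps(2)] by auto
    show "?e \<epsilon> x \<bullet> ?e \<epsilon> x > 0" using e_pos[OF \<epsilon>] .
    assume v: "v \<in> eigen_fibre n A s \<epsilon> x"
    have *: "comb p (T \<epsilon> x v) = (- \<epsilon>) *\<^sub>R T \<epsilon> x v" "T \<epsilon> x v \<bullet> x = 0" "\<And>i. i \<le> n \<Longrightarrow> A i x \<bullet> T \<epsilon> x v = 0"
      "T (- \<epsilon>) x (T \<epsilon> x v) = v"
      using transfer_eigen_fibre[OF dim p eps(1) _ \<open>n \<le> m\<close> e_eigen[OF eps(2)] e_eigen[OF \<epsilon>] ne(2) ne(1), of v]
        v[unfolded fibre]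
      unfolding x T_def by (auto simp: p_def)
    then show "T \<epsilon> x v \<in> eigen_fibre n A s (- \<epsilon>) x" "T (- \<epsilon>) x (T \<epsilon> x v) = v"
      by (auto simp: fibre)
  qed
  have cont: "continuous_on (Sigma M (eigen_fibre n A s \<delta>)) (\<lambda>p. (fst p, T \<epsilon> (fst p) (snd p)))"
    if "\<epsilon> \<in> {1, - 1}" for \<epsilon> \<delta>
  proof -
    have "?e (- \<epsilon>) (fst p) \<noteq> 0" if "p \<in> Sigma M (eigen_fibre n A s \<delta>)" for p
      using nz[of "fst p" "- \<epsilon>"] that \<open>\<epsilon> \<in> {1, - 1}\<close> by auto
    then show ?thesis
      unfolding T_def by (intro continuous_intros) (use \<open>n \<le> m\<close> in auto)
  qed
  show ?thesis
    unfolding vector_bundle_isomorphic_def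
  proof (intro exI conjI ballI allI)
    show "homeomorphism (Sigma M (eigen_fibre n A s 1)) (Sigma M (eigen_fibre n A s (- 1)))
        (\<lambda>p. (fst p, T 1 (fst p) (snd p))) (\<lambda>p. (fst p, T (- 1) (fst p) (snd p)))"
    proof (rule homeomorphismI)
      show "continuous_on (Sigma M (eigen_fibre n A s 1)) (\<lambda>p. (fst p, T 1 (fst p) (snd p)))"
        "continuous_on (Sigma M (eigen_fibre n A s (- 1))) (\<lambda>p. (fst p, T (- 1) (fst p) (snd p)))"
        by (rule cont; simp)+
    next
      show "(\<lambda>p. (fst p, T 1 (fst p) (snd p))) ` Sigma M (eigen_fibre n A s 1) \<subseteq> Sigma M (eigen_fibre n A s (- 1))"
        using T[of _ 1] by auto
      show "(\<lambda>p. (fst p, T (- 1) (fst p) (snd p))) ` Sigma M (eigen_fibre n A s (- 1)) \<subseteq> Sigma M (eigen_fibre n A s 1)"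
        using T[of _ "- 1"] by auto
    qed (use TT[of _ 1] TT[of _ "- 1"] in auto)
  qed (auto simp: T_def inner_add_left add_divide_distrib scaleR_add_left sum.distrib
      scaleR_sum_right)
qed

end

section \<open>Extending a Clifford system\<close>

text \<open>The signs of seven pairwise anticommuting complex structures \<open>L\<^sub>k e\<^sub>i = octonion_sign k i \<cdot> e\<^bsub>xor i k\<^esub>\<close>
  of \<open>\<real>\<^sup>8\<close>, as they arise from multiplication by imaginary octonion units. Each \<open>L\<^sub>k\<close> is a tensor product of three
  \<open>2 \<times> 2\<close> matrices acting on the binary digits of \<open>i\<close>, and the sign is negative iff \<open>i\<close> shares an odd number
  of digits 1 with the \<open>k\<close>-th member of the list \<open>1, 3, 6, 7, 4, 5, 2\<close>. Row 0 belongs to the identity. The first three structures preserve the span of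
  \<open>e\<^sub>0, \<dots>, e\<^sub>3\<close> and form a quaternionic triple there.\<close>

definition octonion_sign :: "nat \<Rightarrow> nat \<Rightarrow> int" where
  "octonion_sign k i =
    [[1,  1,  1,  1,  1,  1,  1,  1],
     [1, -1,  1, -1,  1, -1,  1, -1],
     [1, -1, -1,  1,  1, -1, -1,  1],
     [1,  1, -1, -1, -1, -1,  1,  1],
     [1, -1, -1,  1, -1,  1,  1, -1],
     [1,  1,  1,  1, -1, -1, -1, -1],
     [1, -1,  1, -1, -1,  1, -1,  1],
     [1,  1, -1, -1,  1,  1, -1, -1]] ! k ! i"

lemma octonion_sign_anticommute:
  assumes "k \<in> {1..<8}" "k' \<in> {1..<8}" "i < 8"
  shows "octonion_sign k' i * octonion_sign k (xor i k') + octonion_sign k i * octonion_sign k' (xor i k)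
    = (if k = k' then - 2 else 0)"
proof -
  have "\<forall>k\<in>set [1..<8]. \<forall>k'\<in>set [1..<8]. \<forall>i\<in>set [0..<8].
    octonion_sign k' i * octonion_sign k (xor i k') + octonion_sign k i * octonion_sign k' (xor i k)
    = (if k = k' then - 2 else 0)"
    by code_simp
  then show ?thesis using assms by simp
qed

lemma octonion_sign_skew:
  assumes "k \<in> {1..<8}" "i < 8"
  shows "octonion_sign k (xor i k) = - octonion_sign k i"
proof -
  have "\<forall>k\<in>set [1..<8]. \<forall>i\<in>set [0..<8]. octonion_sign k (xor i k) = - octonion_sign k i"
    by code_simp
  then show ?thesis using assms by simp
qed

lemma xor_less_power_2:
  fixes k i :: nat
  assumes "k < 2 ^ n" "i < 2 ^ n"
  shows "xor k i < 2 ^ n"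
  using assms by (metis take_bit_nat_eq_self take_bit_nat_less_exp take_bit_xor)

lemma xor_cancel_right: "xor (xor i k) k = (i :: nat)"
  by (simp add: ac_simps)

lemma xor_swap_right: "xor (xor i k) k' = xor (xor i k') (k :: nat)"
  by (simp add: ac_simps)

context clifford_family
begin

text \<open>A vector orthogonal to \<open>S\<close> and \<open>A 1 ` S\<close> exists for reasons of dimension. Either its component in the
  \<open>1\<close>-eigenspace of \<open>A 0\<close> is nonzero, or it lies in the other eigenspace and \<open>A 1\<close> moves it over.\<close>

lemma unit_vector_exists:
  assumes "1 \<le> m" "finite S" "\<And>y. y \<in> S \<Longrightarrow> A 0 y = y" "2 * card S < DIM('a)"
  obtains e where "e \<bullet> e = 1" "A 0 e = e" "\<And>y. y \<in> S \<Longrightarrow> y \<bullet> e = 0"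
proof -
  note lin = linear_scale[OF linear_A] linear_add[OF linear_A] linear_diff[OF linear_A]
  have "dim (S \<union> A 1 ` S) \<le> card (S \<union> A 1 ` S)"
    using \<open>finite S\<close> by (intro dim_le_card') auto
  also have "\<dots> \<le> card S + card (A 1 ` S)"
    by (rule card_Un_le)
  also have "\<dots> \<le> 2 * card S"
    using card_image_le[OF \<open>finite S\<close>, of "A 1"] by simp
  finally obtain z where z: "z \<noteq> 0" "\<And>y. y \<in> span (S \<union> A 1 ` S) \<Longrightarrow> orthogonal z y"
    using assms(4) orthogonal_to_subspace_exists by (metis order_le_less_trans)
  have zS: "z \<bullet> y = 0" "z \<bullet> A 1 y = 0" if "y \<in> S" for y
    using z(2) that by (auto simp: orthogonal_def span_base)
  obtain y where y: "y \<noteq> 0" "A 0 y = y" "\<And>x. x \<in> S \<Longrightarrow> x \<bullet> y = 0"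
  proof (cases "z + A 0 z = 0")
    case False
    show ?thesis
    proof (rule that[OF False])
      show "A 0 (z + A 0 z) = z + A 0 z" by (simp add: lin A_A add.commute)
      show "x \<bullet> (z + A 0 z) = 0" if "x \<in> S" for x
        using zS[OF that] sym_A[of 0 x z] assms(3)[OF that]
        by (simp add: inner_add_right inner_commute)
    qed
  next
    case True
    then have z0: "A 0 z = - z" by (simp add: eq_neg_iff_add_eq_0 add.commute)
    show ?thesis
    proof (rule that)
      show "A 1 z \<noteq> 0"
        using A_A[of 1 z] \<open>1 \<le> m\<close> \<open>z \<noteq> 0\<close> linear_0[OF linear_A, of 1] by auto
      show "A 0 (A 1 z) = A 1 z"
        using A_anti[of 0 1 z] \<open>1 \<le> m\<close> by (simp add: z0 linear_neg[OF linear_A])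
      show "x \<bullet> A 1 z = 0" if "x \<in> S" for x
        using zS[OF that] sym_A[of 1 x z] \<open>1 \<le> m\<close> by (simp add: inner_commute)
    qed
  qed
  show ?thesis
  proof (rule that)
    show "(y /\<^sub>R norm y) \<bullet> (y /\<^sub>R norm y) = 1"
      using y(1) by (simp add: dot_square_norm power2_eq_square)
  qed (use y in \<open>auto simp: lin\<close>)
qed

text \<open>The maps \<open>g b\<close> play the role of a group acting by isometries on the \<open>1\<close>-eigenspace of \<open>A 0\<close>: by the second
  assumption on them the orthogonal complement of a union of orbits is invariant, so that orthonormal orbits
  can be added one at a time.\<close>

lemma orbit_basis_exists:
  fixes g :: "nat \<Rightarrow> 'a \<Rightarrow> 'a"
  assumes "1 \<le> m"
    and g0: "\<And>b u. b < q \<Longrightarrow> A 0 u = u \<Longrightarrow> A 0 (g b u) = g b u"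
    and gg: "\<And>b c. b < q \<Longrightarrow> c < q \<Longrightarrow> \<exists>d<q. \<exists>\<sigma>. \<forall>u v. g b u \<bullet> g c v = \<sigma> * (g d u \<bullet> v)"
    and on: "\<And>b c u. b < q \<Longrightarrow> c < q \<Longrightarrow> g b u \<bullet> g c u = (if b = c then u \<bullet> u else 0)"
    and "2 * (N * q) \<le> DIM('a)" "0 < q"
  shows "\<exists>f. (\<forall>a<N. A 0 (f a) = f a) \<and> (\<forall>a<N. \<forall>a'<N. \<forall>b<q. \<forall>c<q.
      g b (f a) \<bullet> g c (f a') = (if a = a' \<and> b = c then 1 else 0))"
  using \<open>2 * (N * q) \<le> DIM('a)\<close>
proof (induction N)
  case 0
  then show ?case by simp
next
  case (Suc N)
  have "2 * (N * q) \<le> DIM('a)"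
    using Suc.prems by simp
  from Suc.IH[OF this] obtain f where f: "\<And>a. a < N \<Longrightarrow> A 0 (f a) = f a"
    "\<And>a a' b c. a < N \<Longrightarrow> a' < N \<Longrightarrow> b < q \<Longrightarrow> c < q \<Longrightarrow>
      g b (f a) \<bullet> g c (f a') = (if a = a' \<and> b = c then 1 else 0)"
    by metis
  define S where "S = (\<lambda>(a, b). g b (f a)) ` ({..<N} \<times> {..<q})"
  have "card S \<le> N * q"
    unfolding S_def by (rule order_trans[OF card_image_le]) simp_all
  then have "2 * card S < DIM('a)"
    using Suc.prems \<open>0 < q\<close> by simp
  moreover have "finite S" "\<And>y. y \<in> S \<Longrightarrow> A 0 y = y"
    using g0 f(1) by (auto simp: S_def)
  ultimately obtain e where e: "e \<bullet> e = 1" "A 0 e = e" "\<And>y. y \<in> S \<Longrightarrow> y \<bullet> e = 0"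
    using unit_vector_exists \<open>1 \<le> m\<close> by metis
  have old: "g b (f a) \<bullet> g c e = 0" if "a < N" "b < q" "c < q" for a b c
  proof -
    obtain d \<sigma> where "d < q" "g b (f a) \<bullet> g c e = \<sigma> * (g d (f a) \<bullet> e)"
      using gg[OF \<open>b < q\<close> \<open>c < q\<close>] by blast
    moreover have "g d (f a) \<in> S"
      using that \<open>d < q\<close> by (force simp: S_def)
    ultimately show ?thesis using e(3) by simp
  qed
  then have old': "g c e \<bullet> g b (f a) = 0" if "a < N" "b < q" "c < q" for a b c
    using that by (simp add: inner_commute)
  show ?case
    by (rule exI[of _ "\<lambda>a. if a < N then f a else e"]) (auto simp: f e on old old')
qed

text \<open>An orthonormal family in the \<open>1\<close>-eigenspace of \<open>A 0\<close> on which the complex structures \<open>A 1 \<circ> A (Suc k)\<close> that are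
  already present act with the prescribed signs.\<close>

definition adapted_basis :: "nat \<Rightarrow> (nat \<Rightarrow> 'a) \<Rightarrow> bool" where
  "adapted_basis l e \<longleftrightarrow> (\<forall>i<l. A 0 (e i) = e i) \<and>
     (\<forall>i<l. \<forall>j<l. e i \<bullet> e j = (if i = j then 1 else 0)) \<and>
     (\<forall>k i. 1 \<le> k \<longrightarrow> k < m \<longrightarrow> i < l \<longrightarrow>
        A (Suc k) (e i) = of_int (octonion_sign k i) *\<^sub>R A 1 (e (xor i k)))"

text \<open>The complex structures \<open>J = A 1 \<circ> A 2\<close> and \<open>K = A 1 \<circ> A 3\<close>, as far as they exist, generate up to sign a group with
  \<open>q = 2 ^ (m - 1)\<close> elements \<open>id, J, K, J \<circ> K\<close>, indexed so that composition is \<open>xor\<close>. Its orbits have the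
  required form since rows 1 and 2 of the sign table repeat with period 4.\<close>

lemma adapted_basis_exists:
  assumes dim: "DIM('a) = 2 * l" and "(m, l) \<in> {(1, 4), (1, 8), (2, 8), (3, 8)}"
  shows "\<exists>e. adapted_basis l e"
proof -
  define q where "q = (2::nat) ^ (m - 1)"
  define g where "g b u = (if b = 0 then u else if b = 1 then A 1 (A 2 u)
      else if b = 2 then A 1 (A 3 u) else A 3 (A 2 u))" for b :: nat and u
  have m: "1 \<le> m" "m = 1 \<or> m = 2 \<or> m = 3" and l: "l = (l div q) * q" and "0 < q"
    using assms by (auto simp: q_def)
  \<comment> \<open>Sorting indices brings every word in the operators into a normal form.\<close>
  have sort: "1 \<le> m \<Longrightarrow> A 1 (A 0 x) = - A 0 (A 1 x)" "2 \<le> m \<Longrightarrow> A 2 (A 0 x) = - A 0 (A 2 x)"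
    "3 \<le> m \<Longrightarrow> A 3 (A 0 x) = - A 0 (A 3 x)" "2 \<le> m \<Longrightarrow> A 2 (A 1 x) = - A 1 (A 2 x)"
    "3 \<le> m \<Longrightarrow> A 3 (A 1 x) = - A 1 (A 3 x)" "3 \<le> m \<Longrightarrow> A 3 (A 2 x) = - A 2 (A 3 x)" for x
    by (rule A_anti; simp)+
  note neg = linear_neg[OF linear_A]
  note [simp del] = One_nat_def
  have q_cases: "b = 0 \<or> (b = 1 \<and> 2 \<le> m) \<or> (b = 2 \<and> 3 \<le> m) \<or> (b = 3 \<and> 3 \<le> m)" if "b < q" for b
    using that m(2) by (auto simp: q_def)
  have g0: "A 0 (g b u) = g b u" if "b < q" "A 0 u = u" for b u
    using q_cases[OF that(1)] that(2)
    by (elim disjE) (auto simp: g_def A_anti[of 0 1] A_anti[of 0 2] A_anti[of 0 3] A_anti[of 2 3] neg)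
  have adj: "g b u \<bullet> v = (if b = 0 then 1 else - 1) * (u \<bullet> g b v)" if "b < q" for b u v
    using q_cases[OF that] by (elim disjE) (auto simp: g_def sym_A sort neg)
  have mult: "(\<forall>u. g c (g b u) = g (xor b c) u) \<or> (\<forall>u. g c (g b u) = - g (xor b c) u)"
    if "b < q" "c < q" for b c
    using q_cases[OF that(1)] q_cases[OF that(2)] by (elim disjE) (auto simp: g_def sort neg A_A)
  have xor_q: "xor b c < q" if "b < q" "c < q" for b c
    using that unfolding q_def by (rule xor_less_power_2)
  have gg: "\<exists>d<q. \<exists>\<sigma>. \<forall>u v. g b u \<bullet> g c v = \<sigma> * (g d u \<bullet> v)" if "b < q" "c < q" for b c
  proof -
    from mult[OF that] have "\<exists>\<sigma>::real. \<forall>u. g c (g b u) = \<sigma> *\<^sub>R g (xor b c) u"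
      by (metis scaleR_one scaleR_minus1_left)
    then obtain \<sigma> :: real where \<sigma>: "\<And>u. g c (g b u) = \<sigma> *\<^sub>R g (xor b c) u"
      by blast
    have "g b u \<bullet> g c v = ((if c = 0 then 1 else - 1) * \<sigma>) * (g (xor b c) u \<bullet> v)" for u v
      using adj[OF \<open>c < q\<close>, of "g b u" v] by (auto simp: \<sigma> split: if_splits)
    then show ?thesis using xor_q[OF that] by blast
  qed
  have on: "g b u \<bullet> g c u = (if b = c then u \<bullet> u else 0)" if "b < q" "c < q" for b c u
  proof (cases "b = c")
    case True
    then show ?thesis
      using q_cases[OF that(1)] by (elim disjE) (auto simp: g_def inner_A_A)
  next
    case False
    then have "xor b c \<noteq> 0"
      using xor_cancel_right[of b c] by (metis xor.left_neutral)
    then have "g (xor b c) u \<bullet> u = 0"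
      using adj[OF xor_q[OF that], of u u] by (simp add: inner_commute)
    moreover have "g b u \<bullet> g c u = g c (g b u) \<bullet> u \<or> g b u \<bullet> g c u = - (g c (g b u) \<bullet> u)"
      using adj[OF \<open>c < q\<close>, of "g b u" u] by (auto split: if_splits)
    ultimately show ?thesis
      using mult[OF that] False by auto
  qed
  have "2 * (l div q * q) \<le> DIM('a)"
    using dim by (simp flip: l)
  from orbit_basis_exists[OF m(1) g0 gg on this \<open>0 < q\<close>]
  obtain f where f: "\<And>a. a < l div q \<Longrightarrow> A 0 (f a) = f a"
    "\<And>a a' b c. a < l div q \<Longrightarrow> a' < l div q \<Longrightarrow> b < q \<Longrightarrow> c < q \<Longrightarrow>
      g b (f a) \<bullet> g c (f a') = (if a = a' \<and> b = c then 1 else 0)"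
    by metis
  define e where "e i = g (i mod q) (f (i div q))" for i
  have div: "i div q < l div q" if "i < l" for i
    using that l \<open>0 < q\<close> by (metis less_mult_imp_div_less)
  have "A 0 (e i) = e i" if "i < l" for i
    using that div \<open>0 < q\<close> by (simp add: e_def g0 f)
  moreover have "e i \<bullet> e j = (if i = j then 1 else 0)" if "i < l" "j < l" for i j
    using that div \<open>0 < q\<close> f(2)[of "i div q" "j div q" "i mod q" "j mod q"] 
    by (auto simp: e_def) (metis div_mult_mod_eq)
  moreover have "A (Suc k) (e i) = of_int (octonion_sign k i) *\<^sub>R A 1 (e (xor i k))"
    if "1 \<le> k" "k < m" "i < l" for k i
  proof -
    have "i = 0 \<or> i = 1 \<or> i = 2 \<or> i = 3 \<or> i = 4 \<or> i = 5 \<or> i = 6 \<or> i = 7"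
    proof -
      have "i < 8" using that(3) assms(2) by auto
      then show ?thesis by (simp add: numeral_eq_Suc less_Suc_eq One_nat_def disj_commute disj_left_commute)
    qed
    moreover have "(m = 2 \<and> k = 1) \<or> (m = 3 \<and> k = 1) \<or> (m = 3 \<and> k = 2)"
      using that m by auto
    ultimately show ?thesis
      by (elim disjE) (simp_all add: e_def q_def g_def octonion_sign_def sort neg A_A)
  qed
  ultimately show ?thesis
    unfolding adapted_basis_def by blast
qed

text \<open>The map that is \<open>A 1 \<circ> L\<^sub>k\<close> on the vectors \<open>e i\<close> and \<open>- L\<^sub>k \<circ> A 1\<close> on the vectors \<open>A 1 (e i)\<close>; the second
  formula is forced by anticommutation with \<open>A 1\<close>.\<close>

definition octonion_operator :: "nat \<Rightarrow> (nat \<Rightarrow> 'a) \<Rightarrow> nat \<Rightarrow> 'a \<Rightarrow> 'a" where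
  "octonion_operator l e k x = (\<Sum>i<l. of_int (octonion_sign k i) *\<^sub>R
     ((x \<bullet> e i) *\<^sub>R A 1 (e (xor i k)) - (x \<bullet> A 1 (e i)) *\<^sub>R e (xor i k)))"

text \<open>The system is enlarged by the maps that correspond to the remaining rows of the sign table. This is
  possible because for \<open>m \<le> 3\<close> a Clifford system is determined by its dimension up to an orthogonal change of
  coordinates, here the one given by an adapted basis.\<close>

lemma clifford_extension:
  assumes dim: "DIM('a) = 2 * l" and ml: "(m, l) \<in> {(1, 4), (1, 8), (2, 8), (3, 8)}"
  shows "\<exists>B. clifford_family l B \<and> (\<forall>i\<le>m. B i = A i)"
proof -
  note [simp del] = One_nat_def
  obtain e where "adapted_basis l e"
    using adapted_basis_exists[OF assms] by blast
  then have e0: "\<And>i. i < l \<Longrightarrow> A 0 (e i) = e i"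
    and ee: "\<And>i j. i < l \<Longrightarrow> j < l \<Longrightarrow> e i \<bullet> e j = (if i = j then 1 else 0)"
    and adapted: "\<And>k i. 1 \<le> k \<Longrightarrow> k < m \<Longrightarrow> i < l \<Longrightarrow>
        A (Suc k) (e i) = of_int (octonion_sign k i) *\<^sub>R A 1 (e (xor i k))"
    unfolding adapted_basis_def by blast+
  have m: "1 \<le> m" "m < l" and l8: "l \<le> 8" using ml by auto
  have xor_less: "xor i k < l" if "i < l" "k < l" for i k
    using that ml xor_less_power_2[of i 2 k] xor_less_power_2[of i 3 k] by auto
  have A1A1: "A 1 (A 1 x) = x" for x using A_A m by simp
  have A01: "A 0 (A 1 x) = - A 1 (A 0 x)" for x using A_anti[of 0 1 x] m by simp
  have A1A1_inner: "A 1 x \<bullet> A 1 y = x \<bullet> y" for x y using inner_A_A m by simp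
  have e_A1e: "e i \<bullet> A 1 (e j) = 0" if "i < l" "j < l" for i j
    using sym_A[of 0 "e i" "A 1 (e j)"] that by (simp add: A01 e0)
  have A1e_e: "A 1 (e i) \<bullet> e j = 0" if "i < l" "j < l" for i j
    using e_A1e[OF that(2,1)] by (simp add: inner_commute)
  define R where "R = octonion_operator l e"
  have R_e: "R k (e h) = of_int (octonion_sign k h) *\<^sub>R A 1 (e (xor h k))" if "h < l" for k h
  proof -
    have "R k (e h) = (\<Sum>i<l. if i = h then of_int (octonion_sign k h) *\<^sub>R A 1 (e (xor h k)) else 0)"
      unfolding R_def octonion_operator_def using that by (intro sum.cong refl) (auto simp: ee e_A1e)
    then show ?thesis using that by simp
  qed
  have R_A1e: "R k (A 1 (e h)) = - of_int (octonion_sign k h) *\<^sub>R e (xor h k)" if "h < l" for k h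
  proof -
    have "R k (A 1 (e h)) = (\<Sum>i<l. if i = h then - of_int (octonion_sign k h) *\<^sub>R e (xor h k) else 0)"
      unfolding R_def octonion_operator_def using that by (intro sum.cong refl) (auto simp: ee A1e_e A1A1_inner)
    then show ?thesis using that by simp
  qed
  have R_linear: "linear (R k)" for k
  proof (rule linearI)
    show "R k (x + y) = R k x + R k y" for x y
      unfolding R_def octonion_operator_def sum.distrib[symmetric]
      by (intro sum.cong refl) (simp add: inner_add_left algebra_simps)
    show "R k (r *\<^sub>R x) = r *\<^sub>R R k x" for r x
      unfolding R_def octonion_operator_def scaleR_sum_right
      by (intro sum.cong refl) (simp add: algebra_simps)
  qed
  have R_sym: "R k x \<bullet> y = x \<bullet> R k y" if "k \<in> {1..<l}" for k x y
  proof -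
    have "x \<bullet> R k y = (\<Sum>i<l. of_int (octonion_sign k i) *
        ((y \<bullet> e i) * (x \<bullet> A 1 (e (xor i k))) - (y \<bullet> A 1 (e i)) * (x \<bullet> e (xor i k))))"
      by (simp add: R_def octonion_operator_def inner_sum_right inner_diff_right)
    also have "\<dots> = (\<Sum>i<l. of_int (octonion_sign k (xor i k)) *
        ((y \<bullet> e (xor i k)) * (x \<bullet> A 1 (e i)) - (y \<bullet> A 1 (e (xor i k))) * (x \<bullet> e i)))"
      by (rule sum.reindex_bij_witness[of _ "\<lambda>i. xor i k" "\<lambda>i. xor i k"])
         (use that in \<open>auto simp: xor_less xor_cancel_right\<close>)
    also have "\<dots> = (\<Sum>i<l. of_int (octonion_sign k i) *
        ((x \<bullet> e i) * (A 1 (e (xor i k)) \<bullet> y) - (x \<bullet> A 1 (e i)) * (e (xor i k) \<bullet> y)))"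
      using that l8 by (intro sum.cong refl) (simp add: octonion_sign_skew inner_commute algebra_simps)
    also have "\<dots> = R k x \<bullet> y"
      by (simp add: R_def octonion_operator_def inner_sum_left inner_diff_left)
    finally show ?thesis by simp
  qed
  \<comment> \<open>The vectors \<open>e i\<close> and \<open>A 1 (e i)\<close> form a basis, on which all relations can be checked.\<close>
  have linear_ext: "F = G" if "linear F" "linear G"
    and "\<And>h. h < l \<Longrightarrow> F (e h) = G (e h)" "\<And>h. h < l \<Longrightarrow> F (A 1 (e h)) = G (A 1 (e h))" for F G :: "'a \<Rightarrow> 'a"
  proof
    fix x
    define b where "b = (\<lambda>(i, k). if k then e i else A 1 (e i))"
    let ?I = "{..<l} \<times> (UNIV :: bool set)"
    have "x = (\<Sum>p\<in>?I. (x \<bullet> b p) *\<^sub>R b p)"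
      by (rule orthonormal_family_expansion) (auto simp: dim b_def ee e_A1e A1e_e A1A1_inner split: if_splits)
    moreover have "F (b p) = G (b p)" if "p \<in> ?I" for p
      using that \<open>\<And>h. h < l \<Longrightarrow> F (e h) = G (e h)\<close> \<open>\<And>h. h < l \<Longrightarrow> F (A 1 (e h)) = G (A 1 (e h))\<close>
      by (auto simp: b_def)
    then have "F (\<Sum>p\<in>?I. (x \<bullet> b p) *\<^sub>R b p) = G (\<Sum>p\<in>?I. (x \<bullet> b p) *\<^sub>R b p)"
      by (simp add: linear_sum[OF \<open>linear F\<close>] linear_sum[OF \<open>linear G\<close>]
          linear_scale[OF \<open>linear F\<close>] linear_scale[OF \<open>linear G\<close>] cong: sum.cong)
    ultimately show "F x = G x" by simp
  qed
  note lin = linear_scale[OF linear_A] linear_neg[OF linear_A] linear_scale[OF R_linear] linear_neg[OF R_linear]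
  have lin_sum: "linear (\<lambda>x. F (G x) + G (F x))" if "linear F" "linear G" for F G :: "'a \<Rightarrow> 'a"
    using linear_compose_add[OF linear_compose[OF that(2,1)] linear_compose[OF that]] by (simp add: o_def)
  have R_R: "R k (R k' x) + R k' (R k x) = (if k = k' then 2 else 0) *\<^sub>R x"
    if k: "k \<in> {1..<l}" "k' \<in> {1..<l}" for k k' x
  proof -
    have "(\<lambda>x. R k (R k' x) + R k' (R k x)) = (\<lambda>x. (if k = k' then 2 else 0) *\<^sub>R x)"
    proof (rule linear_ext)
      show "linear (\<lambda>x. R k (R k' x) + R k' (R k x))" "linear (\<lambda>x::'a. (if k = k' then 2 else 0) *\<^sub>R x)"
        by (intro lin_sum R_linear linear_scale_self)+
      fix h assume h: "h < l"
      let ?s = "octonion_sign k' h * octonion_sign k (xor h k') + octonion_sign k h * octonion_sign k' (xor h k)"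
      have s: "?s = (if k = k' then - 2 else 0)"
        using k h l8 by (intro octonion_sign_anticommute) auto
      have "R k (R k' (e h)) + R k' (R k (e h)) = - of_int ?s *\<^sub>R e (xor (xor h k) k')"
        using k h by (simp add: R_e R_A1e lin xor_less xor_swap_right[of h k' k] algebra_simps)
      then show "R k (R k' (e h)) + R k' (R k (e h)) = (if k = k' then 2 else 0) *\<^sub>R e h"
        unfolding s by (simp add: xor_cancel_right)
      have "R k (R k' (A 1 (e h))) + R k' (R k (A 1 (e h))) = - of_int ?s *\<^sub>R A 1 (e (xor (xor h k) k'))"
        using k h by (simp add: R_e R_A1e lin xor_less xor_swap_right[of h k' k] algebra_simps)
      then show "R k (R k' (A 1 (e h))) + R k' (R k (A 1 (e h))) = (if k = k' then 2 else 0) *\<^sub>R A 1 (e h)"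
        unfolding s by (simp add: xor_cancel_right)
    qed
    then show ?thesis by (rule fun_cong)
  qed
  have A0_R: "A 0 (R k x) + R k (A 0 x) = 0" if k: "k \<in> {1..<l}" for k x
  proof -
    have "(\<lambda>x. A 0 (R k x) + R k (A 0 x)) = (\<lambda>x. 0)"
    proof (rule linear_ext)
      show "linear (\<lambda>x. A 0 (R k x) + R k (A 0 x))" "linear (\<lambda>x::'a. 0 :: 'a)"
        by (intro lin_sum R_linear linear_A linear_zero; simp)+
    qed (use k m in \<open>simp_all add: R_e R_A1e lin A01 e0 xor_less del: One_nat_def\<close>)
    then show ?thesis by (rule fun_cong)
  qed
  have A1_R: "A 1 (R k x) + R k (A 1 x) = 0" if k: "k \<in> {1..<l}" for k x
  proof -
    have "(\<lambda>x. A 1 (R k x) + R k (A 1 x)) = (\<lambda>x. 0)"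
    proof (rule linear_ext)
      show "linear (\<lambda>x. A 1 (R k x) + R k (A 1 x))" "linear (\<lambda>x::'a. 0 :: 'a)"
        using m by (intro lin_sum R_linear linear_A linear_zero; simp)+
    qed (use k m in \<open>simp_all add: R_e R_A1e lin A1A1 xor_less del: One_nat_def\<close>)
    then show ?thesis by (rule fun_cong)
  qed
  define B where "B j = (if j \<le> 1 then A j else R (j - 1))" for j
  have pred: "i - 1 \<in> {1..<l}" if "\<not> i \<le> 1" "i \<le> l" for i
    using that by auto
  have "clifford_family l B"
  proof (rule clifford_family.intro)
    show "linear (B i)" if "i \<le> l" for i
      using m by (auto simp: B_def linear_A R_linear)
    show "B i x \<bullet> y = x \<bullet> B i y" if "i \<le> l" for i x y
      using that m R_sym[of "i - 1"] pred by (auto simp: B_def sym_A)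
    show "B i (B j x) + B j (B i x) = (if i = j then 2 else 0) *\<^sub>R x" if "i \<le> l" "j \<le> l" for i j x
    proof -
      have A_R: "A i (R k x) + R k (A i x) = 0" if "i \<le> 1" "k \<in> {1..<l}" for i k
        using that A0_R[of k x] A1_R[of k x] by (cases "i = 0") (auto simp: le_eq_less_or_eq less_one)
      then have R_A: "R k (A i x) + A i (R k x) = 0" if "i \<le> 1" "k \<in> {1..<l}" for i k
        using that by (simp add: add.commute)
      consider "i \<le> 1" "j \<le> 1" | "i \<le> 1" "\<not> j \<le> 1" | "\<not> i \<le> 1" "j \<le> 1" | "\<not> i \<le> 1" "\<not> j \<le> 1"
        by blast
      then show ?thesis
      proof cases
        case 1
        then show ?thesis using m by (simp add: B_def anticomm_A)
      next
        case 2
        then have "i \<noteq> j" by auto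
        with 2 show ?thesis using A_R[OF _ pred] that by (simp add: B_def)
      next
        case 3
        then have "i \<noteq> j" by auto
        with 3 show ?thesis using R_A[OF _ pred] that by (simp add: B_def)
      next
        case 4
        then have "i - 1 = j - 1 \<longleftrightarrow> i = j" by auto
        with 4 show ?thesis using R_R[OF pred pred] that by (simp add: B_def)
      qed
    qed
  qed
  moreover have "B i = A i" if "i \<le> m" for i
  proof (cases "i \<le> 1")
    case False
    define k where "k = i - 1"
    have k: "i = Suc k" "1 \<le> k" "k < m" using False that by (auto simp: k_def)
    have "R k = A i"
    proof (rule linear_ext)
      fix h assume h: "h < l"
      have Ae: "A i (e h) = of_int (octonion_sign k h) *\<^sub>R A 1 (e (xor h k))"
        using adapted[OF k(2,3) h] k(1) by simp
      then show "R k (e h) = A i (e h)"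
        by (simp add: R_e h)
      have "A i (A 1 (e h)) = - A 1 (A i (e h))"
        using A_anti[of i 1 "e h"] that m False by auto
      then show "R k (A 1 (e h)) = A i (A 1 (e h))"
        using m by (simp add: R_A1e h Ae lin A1A1)
    qed (use R_linear linear_A that in auto)
    then show ?thesis using False by (simp add: B_def k_def)
  qed (simp add: B_def)
  ultimately show ?thesis by blast
qed

end

section \<open>Gradients and derivatives on a set\<close>

lemma has_derivative_along_curve:
  fixes f :: "'a::real_normed_vector \<Rightarrow> 'b::real_normed_vector"
  assumes f: "(f has_derivative f') (at (\<gamma> 0) within S)" and "0 < \<delta>" and S: "\<gamma> ` {-\<delta><..<\<delta>} \<subseteq> S"
    and \<gamma>: "(\<gamma> has_vector_derivative v) (at 0)"
  shows "(f \<circ> \<gamma> has_vector_derivative f' v) (at 0)"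
proof -
  let ?I = "{-\<delta><..<\<delta>} :: real set"
  have "(\<gamma> has_derivative (\<lambda>t. t *\<^sub>R v)) (at 0 within ?I)"
    using \<gamma> unfolding has_vector_derivative_def by (rule has_derivative_at_withinI)
  moreover have "(f has_derivative f') (at (\<gamma> 0) within \<gamma> ` ?I)"
    using f S by (rule has_derivative_subset)
  ultimately have "(f \<circ> \<gamma> has_derivative f' \<circ> (\<lambda>t. t *\<^sub>R v)) (at 0 within ?I)"
    by (rule diff_chain_within)
  moreover have "f' \<circ> (\<lambda>t. t *\<^sub>R v) = (\<lambda>t. t *\<^sub>R f' v)"
    using has_derivative_linear[OF f] by (auto simp: linear_scale)
  moreover have "at 0 within ?I = at 0"
    using \<open>0 < \<delta>\<close> by (intro at_within_open) auto
  ultimately show ?thesis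
    by (simp add: has_vector_derivative_def)
qed

text \<open>Both values are the velocity of \<open>f\<close> along a curve in \<open>S\<close> with initial velocity \<open>v\<close>.\<close>

lemma derivative_within_unique_on_tangent_space:
  assumes "v \<in> tangent_space S x"
    and "(f has_derivative f1) (at x within S)" "(f has_derivative f2) (at x within S)"
  shows "f1 v = f2 v"
proof -
  obtain \<gamma> \<delta> where \<gamma>: "0 < \<delta>" "\<gamma> ` {-\<delta><..<\<delta>} \<subseteq> S" "\<gamma> 0 = x" "(\<gamma> has_vector_derivative v) (at 0)"
    using assms(1) by (auto simp: tangent_space_def)
  have "(f \<circ> \<gamma> has_vector_derivative f1 v) (at 0)" "(f \<circ> \<gamma> has_vector_derivative f2 v) (at 0)"
    using has_derivative_along_curve[of f _ \<gamma> S \<delta> v] \<gamma> assms(2,3) by auto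
  then show ?thesis
    by (rule vector_derivative_unique_at)
qed

lemma tangent_space_kernel:
  assumes "v \<in> tangent_space S x" "(f has_derivative f') (at x)" "\<And>y. y \<in> S \<Longrightarrow> f y = c" "x \<in> S"
  shows "f' v = 0"
proof -
  have "(f has_derivative (\<lambda>h. 0)) (at x within S)"
    by (rule has_derivative_transform[of _ _ _ "\<lambda>_. c"]) (use assms in auto)
  then show ?thesis
    using derivative_within_unique_on_tangent_space[OF assms(1) has_derivative_at_withinI[OF assms(2)]]
    by blast
qed

text \<open>A curve of constant norm in the plane of \<open>w\<close> and \<open>v\<close>; it supplies all tangent vectors that are needed.\<close>

lemma rotation_curve:
  fixes w v :: "'a::real_inner"
  assumes "w \<noteq> 0" and "w \<bullet> v = 0"
  obtains \<gamma> where "\<gamma> 0 = w" "(\<gamma> has_vector_derivative v) (at 0)"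
    "\<And>t. \<exists>a b. \<gamma> t = a *\<^sub>R w + b *\<^sub>R v" "\<And>t. \<gamma> t \<bullet> \<gamma> t = w \<bullet> w"
proof (cases "v = 0")
  case True
  show ?thesis
    by (rule that[of "\<lambda>_. w"]) (auto simp: True intro!: exI[of _ 1])
next
  case False
  define k where "k = norm v / norm w"
  have k: "k > 0" "k\<^sup>2 * (w \<bullet> w) = v \<bullet> v"
    using assms(1) False by (auto simp: k_def power_divide power2_norm_eq_inner)
  define \<gamma> where "\<gamma> t = cos (k * t) *\<^sub>R w + (sin (k * t) / k) *\<^sub>R v" for t
  show ?thesis
  proof (rule that[of \<gamma>])
    show "\<gamma> 0 = w" by (simp add: \<gamma>_def)
    show "(\<gamma> has_vector_derivative v) (at 0)"
      unfolding \<gamma>_def has_vector_derivative_def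
      by (rule derivative_eq_intros refl)+ (use k in \<open>auto simp: fun_eq_iff\<close>)
    show "\<exists>a b. \<gamma> t = a *\<^sub>R w + b *\<^sub>R v" for t
      by (auto simp: \<gamma>_def)
    have "\<gamma> t \<bullet> \<gamma> t = (cos (k * t))\<^sup>2 * (w \<bullet> w) + (sin (k * t))\<^sup>2 * ((v \<bullet> v) / k\<^sup>2)" for t
      using assms(2) by (simp add: \<gamma>_def inner_add_left inner_add_right inner_commute[of v w] power2_eq_square)
    moreover have "(v \<bullet> v) / k\<^sup>2 = w \<bullet> w"
      using k by (simp add: field_simps)
    ultimately show "\<gamma> t \<bullet> \<gamma> t = w \<bullet> w" for t
      by (simp flip: distrib_right)
  qed
qed

lemma tangent_space_sphere:
  fixes x :: "'a::real_inner"
  assumes "norm x = 1"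
  shows "tangent_space (sphere 0 1) x = {v. v \<bullet> x = 0}"
proof (intro equalityI subsetI)
  fix v assume v: "v \<in> tangent_space (sphere 0 1) x"
  have "((\<lambda>y. y \<bullet> y) has_derivative (\<lambda>h. x \<bullet> h + h \<bullet> x)) (at x)"
    by (rule derivative_eq_intros refl)+
  from tangent_space_kernel[OF v this, of 1] show "v \<in> {v. v \<bullet> x = 0}"
    using assms by (simp add: inner_commute dot_square_norm)
next
  fix v assume "v \<in> {v. v \<bullet> x = 0}"
  then have "x \<bullet> v = 0" "x \<noteq> 0" using assms by (auto simp: inner_commute)
  then obtain \<gamma> where "\<gamma> 0 = x" "(\<gamma> has_vector_derivative v) (at 0)" "\<And>t. \<gamma> t \<bullet> \<gamma> t = x \<bullet> x"
    using rotation_curve by metis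
  moreover from this have "\<gamma> ` {-1<..<1} \<subseteq> sphere 0 1"
    using assms by (auto simp: norm_eq_sqrt_inner)
  ultimately show "v \<in> tangent_space (sphere 0 1) x"
    unfolding tangent_space_def by (auto intro!: exI[of _ \<gamma>] exI[of _ 1])
qed

lemma gradient_on_sphere:
  fixes x g :: "'a::real_inner"
  assumes x: "norm x = 1" and f: "(f has_derivative (\<lambda>h. g \<bullet> h)) (at x)"
  shows "gradient_on (sphere 0 1) f x = g - (g \<bullet> x) *\<^sub>R x"
  unfolding gradient_on_def
proof (rule the_equality)
  let ?v = "g - (g \<bullet> x) *\<^sub>R x"
  \<comment> \<open>On the sphere \<open>y \<bullet> y - 1\<close> vanishes, so subtracting a multiple of it changes the gradient but not \<open>f\<close>.\<close>
  have xx: "x \<bullet> x = 1" using x by (simp add: dot_square_norm)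
  have v: "?v \<in> tangent_space (sphere 0 1) x"
    by (simp add: tangent_space_sphere[OF x] inner_diff_left xx)
  have "((\<lambda>y. f y - (g \<bullet> x) * ((y \<bullet> y - 1) / 2)) has_derivative (\<lambda>h. ?v \<bullet> h)) (at x)"
    by (rule derivative_eq_intros f refl)+ (auto simp: fun_eq_iff inner_diff_left inner_diff_right inner_commute)
  then have f': "(f has_derivative (\<lambda>h. ?v \<bullet> h)) (at x within sphere 0 1)"
    by (rule has_derivative_transform[rotated 2, OF has_derivative_at_withinI])
       (use x in \<open>auto simp: dot_square_norm\<close>)
  with v show "?v \<in> tangent_space (sphere 0 1) x \<and>
      (f has_derivative (\<lambda>h. ?v \<bullet> h)) (at x within sphere 0 1)"
    by blast
  fix u assume u: "u \<in> tangent_space (sphere 0 1) x \<and>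
      (f has_derivative (\<lambda>h. u \<bullet> h)) (at x within sphere 0 1)"
  have "u - ?v \<in> tangent_space (sphere 0 1) x"
    using u v by (simp add: tangent_space_sphere[OF x] inner_diff_left)
  from derivative_within_unique_on_tangent_space[OF this conjunct2[OF u] f']
  have "(u - ?v) \<bullet> (u - ?v) = 0" by (simp add: inner_diff_left)
  then show "u = ?v" by simp
qed

section \<open>The principal distributions\<close>

text \<open>The Frechet derivative within \<open>M\<close> is an arbitrary choice among many, but on tangent vectors it must agree
  with the derivative of any extension of the normal field.\<close>

lemma shape_operator_eq:
  assumes "X \<in> tangent_space M x" "x \<in> M"
    and "(\<xi> has_derivative \<xi>') (at x)" and "\<And>y. y \<in> M \<Longrightarrow> \<eta> y = \<xi> y"
  shows "shape_operator M \<eta> x X = - \<xi>' X"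
proof -
  have \<eta>: "(\<eta> has_derivative \<xi>') (at x within M)"
    by (rule has_derivative_transform[OF \<open>x \<in> M\<close> assms(4)]) (use assms(3) has_derivative_at_withinI in auto)
  then have "(\<eta> has_derivative frechet_derivative \<eta> (at x within M)) (at x within M)"
    by (meson differentiable_def frechet_derivative_works)
  from derivative_within_unique_on_tangent_space[OF assms(1) this \<eta>] show ?thesis
    by (simp add: shape_operator_def)
qed

text \<open>With \<open>s = sin (2 * \<theta>)\<close> this is the hypersurface, because \<open>cos (4 * \<theta>) = 1 - 2 * s\<^sup>2\<close>.\<close>

definition level_set :: "nat \<Rightarrow> (nat \<Rightarrow> 'a::euclidean_space \<Rightarrow> 'a) \<Rightarrow> real \<Rightarrow> 'a set" where
  "level_set m A s = {x. x \<bullet> x = 1 \<and> (\<Sum>i\<le>m. (A i x \<bullet> x)\<^sup>2) = s\<^sup>2}"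

context clifford_family
begin

lemma has_derivative_A [derivative_intros]:
  "i \<le> m \<Longrightarrow> (f has_derivative f') F \<Longrightarrow> ((\<lambda>x. A i (f x)) has_derivative (\<lambda>h. A i (f' h))) F"
  by (rule bounded_linear.has_derivative[OF linear_A[THEN linear_conv_bounded_linear[THEN iffD1]]])

lemma has_derivative_quadratic:
  assumes "i \<le> m"
  shows "((\<lambda>y. A i y \<bullet> y) has_derivative (\<lambda>h. 2 * (A i x \<bullet> h))) (at x)"
proof -
  have "A i h \<bullet> x = A i x \<bullet> h" for h
    using sym_A[OF assms, of h x] by (simp add: inner_commute)
  moreover have "((\<lambda>y. A i y \<bullet> y) has_derivative (\<lambda>h. A i x \<bullet> h + A i h \<bullet> x)) (at x)"
    by (rule has_derivative_inner[OF has_derivative_A[OF assms has_derivative_ident] has_derivative_ident])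
  ultimately show ?thesis by simp
qed

lemma has_derivative_sum_squares:
  "((\<lambda>y. \<Sum>i\<le>m. (A i y \<bullet> y)\<^sup>2) has_derivative
     (\<lambda>h. 4 * (comb (\<lambda>i. A i x \<bullet> x) x \<bullet> h))) (at x)"
proof -
  have "((\<lambda>y. (A i y \<bullet> y)\<^sup>2) has_derivative
      (\<lambda>h. 4 * ((A i x \<bullet> x) * (A i x \<bullet> h)))) (at x)" if "i \<in> {..m}" for i
    using that has_derivative_power[OF has_derivative_quadratic, of i 2 x]
    by (simp add: mult_ac)
  then have "((\<lambda>y. \<Sum>i\<le>m. (A i y \<bullet> y)\<^sup>2) has_derivative
      (\<lambda>h. \<Sum>i\<le>m. 4 * ((A i x \<bullet> x) * (A i x \<bullet> h)))) (at x)"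
    by (rule has_derivative_sum)
  then show ?thesis
    by (simp add: inner_comb_left sum_distrib_left)
qed

lemma fkm_gradient:
  assumes x: "x \<in> level_set m A s"
  shows "gradient_on (sphere 0 1) (\<lambda>y. norm y ^ 4 - 2 * (\<Sum>i\<le>m. (A i y \<bullet> y)\<^sup>2)) x
    = 8 *\<^sub>R (s\<^sup>2 *\<^sub>R x - comb (\<lambda>i. A i x \<bullet> x) x)"
proof -
  let ?q = "comb (\<lambda>i. A i x \<bullet> x) x"
  have xx: "x \<bullet> x = 1" and s: "(\<Sum>i\<le>m. (A i x \<bullet> x)\<^sup>2) = s\<^sup>2"
    using x by (auto simp: level_set_def)
  have 4: "norm y ^ 4 = (y \<bullet> y)\<^sup>2" for y :: 'a
    by (simp add: dot_square_norm flip: power_mult)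
  have "((\<lambda>y. norm y ^ 4 - 2 * (\<Sum>i\<le>m. (A i y \<bullet> y)\<^sup>2)) has_derivative
      (\<lambda>h. (4 *\<^sub>R x - 8 *\<^sub>R ?q) \<bullet> h)) (at x)"
  proof -
    have "((\<lambda>y. (y \<bullet> y)\<^sup>2 - 2 * f y) has_derivative (\<lambda>h. 4 * (x \<bullet> h) - 2 * f' h)) (at x)"
      if "(f has_derivative f') (at x)" for f f' :: "'a \<Rightarrow> real"
      by (rule derivative_eq_intros that refl)+ (auto simp: fun_eq_iff xx inner_commute)
    from this[OF has_derivative_sum_squares] show ?thesis
      by (simp add: 4 inner_diff_left)
  qed
  from gradient_on_sphere[OF _ this] have "gradient_on (sphere 0 1) (\<lambda>y. norm y ^ 4 - 2 * (\<Sum>i\<le>m. (A i y \<bullet> y)\<^sup>2)) x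
      = (4 *\<^sub>R x - 8 *\<^sub>R ?q) - ((4 *\<^sub>R x - 8 *\<^sub>R ?q) \<bullet> x) *\<^sub>R x"
    using xx by (simp add: norm_eq_sqrt_inner)
  moreover have "?q \<bullet> x = s\<^sup>2"
    using s by (simp add: inner_comb_left power2_eq_square)
  ultimately show ?thesis
    by (simp add: inner_diff_left xx algebra_simps)
qed

lemma norm_fkm_gradient:
  assumes x: "x \<in> level_set m A s" and s: "0 < s" "s < 1"
  shows "norm (8 *\<^sub>R (s\<^sup>2 *\<^sub>R x - comb (\<lambda>i. A i x \<bullet> x) x)) = 8 * s * sqrt (1 - s\<^sup>2)"
proof -
  let ?q = "comb (\<lambda>i. A i x \<bullet> x) x"
  have xx: "x \<bullet> x = 1" and ss: "(\<Sum>i\<le>m. (A i x \<bullet> x)\<^sup>2) = s\<^sup>2"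
    using x by (auto simp: level_set_def)
  have qx: "?q \<bullet> x = s\<^sup>2"
    using ss by (simp add: inner_comb_left power2_eq_square)
  have "?q \<bullet> ?q = s\<^sup>2"
    by (simp add: comb_sym comb_comb ss xx)
  then have "(s\<^sup>2 *\<^sub>R x - ?q) \<bullet> (s\<^sup>2 *\<^sub>R x - ?q) = s\<^sup>2 * (1 - s\<^sup>2)"
    by (simp add: inner_diff_left inner_diff_right qx xx inner_commute[of x ?q] power2_eq_square algebra_simps)
  then have "norm (s\<^sup>2 *\<^sub>R x - ?q) = s * sqrt (1 - s\<^sup>2)"
    using s by (simp add: norm_eq_sqrt_inner real_sqrt_mult)
  then show ?thesis by simp
qed

text \<open>On the level set \<open>s\<close> the unit normal is the restriction of this cubic map for \<open>c = sqrt (1 - s\<^sup>2)\<close>.\<close>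

lemma has_derivative_normal:
  "((\<lambda>y. inverse c *\<^sub>R (s *\<^sub>R y - inverse s *\<^sub>R comb (\<lambda>i. A i y \<bullet> y) y)) has_derivative
    (\<lambda>h. inverse c *\<^sub>R (s *\<^sub>R h - inverse s *\<^sub>R
       (2 *\<^sub>R comb (\<lambda>i. A i x \<bullet> h) x + comb (\<lambda>i. A i x \<bullet> x) h)))) (at x)"
proof -
  have "((\<lambda>y. \<Sum>i\<le>m. (A i y \<bullet> y) *\<^sub>R A i y) has_derivative
      (\<lambda>h. \<Sum>i\<le>m. (A i x \<bullet> x) *\<^sub>R A i h + (2 * (A i x \<bullet> h)) *\<^sub>R A i x)) (at x)"
    using has_derivative_scaleR[OF has_derivative_quadratic has_derivative_A[OF _ has_derivative_ident]]
    by (intro has_derivative_sum) simp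
  then have "((\<lambda>y. comb (\<lambda>i. A i y \<bullet> y) y) has_derivative
      (\<lambda>h. 2 *\<^sub>R comb (\<lambda>i. A i x \<bullet> h) x + comb (\<lambda>i. A i x \<bullet> x) h)) (at x)"
    by (simp add: comb_def sum.distrib scaleR_sum_right add.commute)
  then show ?thesis
    by (intro derivative_intros)
qed

text \<open>Rotating the component \<open>w\<close> of \<open>x = u + w\<close> towards \<open>v\<close> inside the eigenspace, with \<open>u\<close> fixed, keeps all values
  \<open>A i x \<bullet> x\<close> constant: on the eigenspace \<open>A i z \<bullet> z\<close> depends only on \<open>z \<bullet> z\<close>, and the mixed terms vanish
  along the whole curve. So the curve stays in the level set.\<close>

lemma eigen_fibre_tangent:
  assumes x: "x \<in> level_set m A s" and s: "0 < s" "s < 1" and \<epsilon>: "\<epsilon>\<^sup>2 = 1"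
    and v: "v \<in> eigen_fibre m A s \<epsilon> x"
  shows "v \<in> tangent_space (level_set m A s) x"
proof -
  define p where "p i = A i x \<bullet> x / s" for i
  have xx: "x \<bullet> x = 1" and ss: "(\<Sum>i\<le>m. (A i x \<bullet> x)\<^sup>2) = s\<^sup>2"
    using x by (auto simp: level_set_def)
  have p: "(\<Sum>i\<le>m. (p i)\<^sup>2) = 1"
    using s by (simp add: p_def power_divide ss flip: sum_divide_distrib)
  have px: "comb p x \<bullet> x = s"
    using ss s by (simp add: p_def inner_comb_left power2_eq_square flip: sum_divide_distrib)
  have vx: "v \<bullet> x = 0" and vA: "\<And>i. i \<le> m \<Longrightarrow> A i x \<bullet> v = 0" and pv: "comb p v = \<epsilon> *\<^sub>R v"
    using v by (auto simp: eigen_fibre_def pole_def comb_def p_def)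
  define w where "w = (1/2) *\<^sub>R (x + \<epsilon> *\<^sub>R comb p x)"
  define u where "u = (1/2) *\<^sub>R (x + (- \<epsilon>) *\<^sub>R comb p x)"
  have \<epsilon>\<epsilon>: "\<epsilon> * \<epsilon> = 1" "\<epsilon> \<noteq> 0" "(- \<epsilon>)\<^sup>2 = 1" using \<epsilon> by (auto simp: power2_eq_square)
  have "\<epsilon> = 1 \<or> \<epsilon> = - 1" using \<epsilon> by (simp add: power2_eq_1_iff)
  have pw: "comb p w = \<epsilon> *\<^sub>R w" and pu: "comb p u = (- \<epsilon>) *\<^sub>R u"
    unfolding w_def u_def using comb_eigenpart[OF p] \<epsilon> \<epsilon>\<epsilon>(3) by blast+
  have ww: "w \<bullet> w = (1 + \<epsilon> * s) / 2" and uu: "u \<bullet> u = (1 - \<epsilon> * s) / 2"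
    unfolding w_def u_def using inner_eigenpart[OF p \<epsilon>, of x] inner_eigenpart[OF p \<epsilon>\<epsilon>(3), of x]
    by (simp_all add: xx px)
  have "w \<noteq> 0"
    using ww s \<open>\<epsilon> = 1 \<or> \<epsilon> = - 1\<close> by auto
  have xuw: "x = u + w"
    by (simp add: u_def w_def algebra_simps flip: scaleR_add_left)
  have vu: "v \<bullet> u = 0"
    by (rule inner_eigenvectors_opposite[OF pv pu \<epsilon>\<epsilon>(2)])
  have wv: "w \<bullet> v = 0"
    using vx vu by (simp add: xuw inner_add_right inner_commute)
  have wu: "w \<bullet> u = 0"
    by (rule inner_eigenvectors_opposite[OF pw pu \<epsilon>\<epsilon>(2)])
  have Aw: "A i y \<bullet> y' = \<epsilon> * p i * (y \<bullet> y')" if "i \<le> m" "comb p y = \<epsilon> *\<^sub>R y" "comb p y' = \<epsilon> *\<^sub>R y'" for i y y'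
  proof -
    have "\<epsilon> * (\<epsilon> * (A i y \<bullet> y')) = \<epsilon> * (p i * (y \<bullet> y'))"
      using inner_A_eigenvector[OF that(2,3,1)] by simp
    then show ?thesis by (simp add: \<epsilon>\<epsilon> flip: mult.assoc)
  qed
  have Auu: "A i u \<bullet> u = - \<epsilon> * p i * (u \<bullet> u)" if "i \<le> m" for i
  proof -
    have "\<epsilon> * (- \<epsilon> * (A i u \<bullet> u)) = \<epsilon> * (p i * (u \<bullet> u))"
      using inner_A_eigenvector[OF pu pu that] by simp
    then show ?thesis by (simp add: \<epsilon>\<epsilon> flip: mult.assoc)
  qed
  have Auv: "A i u \<bullet> v = 0" if "i \<le> m" for i
    using vA[OF that] Aw[OF that pw pv] wv that by (simp add: xuw linear_add[OF linear_A] inner_add_left)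
  have expand: "A i (u + z) \<bullet> (u + z) = A i u \<bullet> u + 2 * (A i u \<bullet> z) + A i z \<bullet> z" if "i \<le> m" for i z
    using that sym_A[OF that, of u z] by (simp add: linear_add[OF linear_A] inner_add_left inner_add_right inner_commute)
  have Auw: "A i u \<bullet> w = 0" if "i \<le> m" for i
  proof -
    have "s * p i = A i u \<bullet> u + 2 * (A i u \<bullet> w) + A i w \<bullet> w"
      using expand[OF that, of w] s by (simp add: p_def xuw)
    also have "A i u \<bullet> u + 2 * (A i u \<bullet> w) + A i w \<bullet> w = 2 * (A i u \<bullet> w) + (\<epsilon> * \<epsilon>) * s * p i"
      unfolding Auu[OF that] Aw[OF that pw pw] ww uu by (simp add: field_simps)
    finally show ?thesis by (simp add: \<epsilon>\<epsilon>)
  qed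
  obtain \<gamma> where \<gamma>: "\<gamma> 0 = w" "(\<gamma> has_vector_derivative v) (at 0)"
    "\<And>t. \<exists>a b. \<gamma> t = a *\<^sub>R w + b *\<^sub>R v" "\<And>t. \<gamma> t \<bullet> \<gamma> t = w \<bullet> w"
    using rotation_curve[OF \<open>w \<noteq> 0\<close> wv] by blast
  have "u + \<gamma> t \<in> level_set m A s" for t
  proof -
    obtain a b where ab: "\<gamma> t = a *\<^sub>R w + b *\<^sub>R v" using \<gamma>(3) by blast
    have "comb p (\<gamma> t) = \<epsilon> *\<^sub>R \<gamma> t"
      by (simp add: ab linear_add[OF linear_comb] linear_scale[OF linear_comb] pw pv algebra_simps)
    then have z: "A i (\<gamma> t) \<bullet> \<gamma> t = A i w \<bullet> w" if "i \<le> m" for i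
      using Aw[OF that] pw \<gamma>(4) that by simp
    have "A i (u + \<gamma> t) \<bullet> (u + \<gamma> t) = A i x \<bullet> x" if "i \<le> m" for i
      using that by (simp add: expand xuw z Auw) (simp add: ab inner_add_right Auw Auv)
    moreover have "u \<bullet> \<gamma> t = 0" "\<gamma> t \<bullet> u = 0"
      using wu vu by (simp_all add: ab inner_add_right inner_add_left inner_commute[of u w] inner_commute[of u v])
    then have "(u + \<gamma> t) \<bullet> (u + \<gamma> t) = 1"
      by (simp add: inner_add_left inner_add_right \<gamma>(4) ww uu field_simps)
    ultimately show ?thesis by (simp add: level_set_def ss)
  qed
  moreover have "((\<lambda>t. u + \<gamma> t) has_vector_derivative v) (at 0)"
    using has_vector_derivative_add[OF has_vector_derivative_const \<gamma>(2)] by simp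
  ultimately show ?thesis
    unfolding tangent_space_def using \<gamma>(1)
    by (auto simp: xuw intro!: exI[of _ "\<lambda>t. u + \<gamma> t"] exI[of _ 1])
qed

text \<open>For tangent \<open>X\<close> the eigenvalue equation reads \<open>\<epsilon> X - P\<^sub>x X = (2 / s) N x\<close>, where \<open>N = \<Sum>i. (A i x \<bullet> X) A i\<close> anticommutes with
  \<open>P\<^sub>x\<close> because \<open>X\<close> is tangent. Applying \<open>\<epsilon> + P\<^sub>x\<close> kills the left side and leaves
  \<open>N (\<epsilon> x - P\<^sub>x x) = 0\<close>. As \<open>N\<close> is a multiple of an isometry and \<open>\<epsilon> x - P\<^sub>x x \<noteq> 0\<close>, all coefficients of
  \<open>N\<close> vanish, and then \<open>P\<^sub>x X = \<epsilon> X\<close>.\<close>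

lemma principal_space_eq_eigen_fibre:
  assumes x: "x \<in> level_set m A s" and s: "0 < s" "s < 1" and \<epsilon>: "\<epsilon>\<^sup>2 = 1"
    and c: "c = sqrt (1 - s\<^sup>2)" and \<kappa>: "s + c * \<kappa> = \<epsilon>"
    and \<eta>: "\<And>y. y \<in> level_set m A s \<Longrightarrow>
      \<eta> y = inverse c *\<^sub>R (s *\<^sub>R y - inverse s *\<^sub>R comb (\<lambda>i. A i y \<bullet> y) y)"
  shows "{X \<in> tangent_space (level_set m A s) x. shape_operator (level_set m A s) \<eta> x X = \<kappa> *\<^sub>R X}
    = eigen_fibre m A s \<epsilon> x"
proof -
  let ?M = "level_set m A s"
  define p where "p i = A i x \<bullet> x / s" for i
  have xx: "x \<bullet> x = 1" and ss: "(\<Sum>i\<le>m. (A i x \<bullet> x)\<^sup>2) = s\<^sup>2"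
    using x by (auto simp: level_set_def)
  have \<epsilon>\<epsilon>: "\<epsilon> * \<epsilon> = 1" using \<epsilon> by (simp add: power2_eq_square)
  have "s\<^sup>2 < 1" using s by (simp add: power_less_one_iff abs_square_less_1)
  then have "c \<noteq> 0" using c by auto
  have p: "(\<Sum>i\<le>m. (p i)\<^sup>2) = 1"
    using s by (simp add: p_def power_divide ss flip: sum_divide_distrib)
  have px: "comb p x \<bullet> x = s"
    using ss s by (simp add: p_def inner_comb_left power2_eq_square flip: sum_divide_distrib)
  have qp: "comb (\<lambda>i. A i x \<bullet> x) y = s *\<^sub>R comb p y" for y
    using s by (simp add: comb_def p_def scaleR_sum_right)
  have fibre: "X \<in> eigen_fibre m A s \<epsilon> x \<longleftrightarrow>
      X \<bullet> x = 0 \<and> (\<forall>i\<le>m. A i x \<bullet> X = 0) \<and> comb p X = \<epsilon> *\<^sub>R X" for X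
    by (simp add: eigen_fibre_def pole_def comb_def p_def)
  have shape_iff: "shape_operator ?M \<eta> x X = \<kappa> *\<^sub>R X \<longleftrightarrow>
      \<epsilon> *\<^sub>R X - comb p X = (2 / s) *\<^sub>R comb (\<lambda>i. A i x \<bullet> X) x"
    if "X \<in> tangent_space ?M x" for X
  proof -
    let ?n = "comb (\<lambda>i. A i x \<bullet> X) x"
    have "shape_operator ?M \<eta> x X = - (inverse c *\<^sub>R (s *\<^sub>R X - inverse s *\<^sub>R (2 *\<^sub>R ?n + s *\<^sub>R comb p X)))"
      using shape_operator_eq[OF that x has_derivative_normal \<eta>] by (simp add: qp)
    also have "\<dots> = inverse c *\<^sub>R ((2 / s) *\<^sub>R ?n + comb p X - s *\<^sub>R X)"
      using s by (simp add: algebra_simps divide_inverse)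
    finally have "shape_operator ?M \<eta> x X = \<kappa> *\<^sub>R X \<longleftrightarrow>
        c *\<^sub>R (inverse c *\<^sub>R ((2 / s) *\<^sub>R ?n + comb p X - s *\<^sub>R X)) = c *\<^sub>R (\<kappa> *\<^sub>R X)"
      using \<open>c \<noteq> 0\<close> by (simp only: scaleR_cancel_left) simp
    also have "\<dots> \<longleftrightarrow> (2 / s) *\<^sub>R ?n + comb p X - s *\<^sub>R X = (c * \<kappa>) *\<^sub>R X"
      using \<open>c \<noteq> 0\<close> by simp
    also have "\<dots> \<longleftrightarrow> \<epsilon> *\<^sub>R X - comb p X = (2 / s) *\<^sub>R ?n"
      by (auto simp: \<kappa>[symmetric] algebra_simps)
    finally show ?thesis .
  qed
  show ?thesis
  proof (intro equalityI subsetI)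
    fix X assume X: "X \<in> {X \<in> tangent_space ?M x. shape_operator ?M \<eta> x X = \<kappa> *\<^sub>R X}"
    then have tangent: "X \<in> tangent_space ?M x" by simp
    let ?n = "\<lambda>i. A i x \<bullet> X"
    have eq: "\<epsilon> *\<^sub>R X - comb p X = (2 / s) *\<^sub>R comb ?n x"
      using X shape_iff by auto
    have "((\<lambda>y. y \<bullet> y) has_derivative (\<lambda>h. x \<bullet> h + h \<bullet> x)) (at x)"
      by (rule derivative_eq_intros refl)+
    from tangent_space_kernel[OF tangent this _ x, of 1] have Xx: "X \<bullet> x = 0"
      by (simp add: level_set_def inner_commute)
    have "4 * (comb (\<lambda>i. A i x \<bullet> x) x \<bullet> X) = 0"
      by (rule tangent_space_kernel[OF tangent has_derivative_sum_squares _ x, of "s\<^sup>2"])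
         (simp add: level_set_def)
    then have pn: "(\<Sum>i\<le>m. p i * ?n i) = 0"
      using s by (simp add: qp inner_comb_left)
    define y where "y = \<epsilon> *\<^sub>R x - comb p x"
    have "comb p (comb ?n x) = - comb ?n (comb p x)"
      using comb_anticomm[of p ?n x] by (simp add: pn eq_neg_iff_add_eq_0)
    then have "comb p (\<epsilon> *\<^sub>R X - comb p X) = - (2 / s) *\<^sub>R comb ?n (comb p x)"
      unfolding eq by (simp add: linear_scale[OF linear_comb])
    moreover have "comb p (\<epsilon> *\<^sub>R X - comb p X) = - (\<epsilon> *\<^sub>R (\<epsilon> *\<^sub>R X - comb p X))"
      using \<epsilon>\<epsilon> by (simp add: linear_diff[OF linear_comb] linear_scale[OF linear_comb] comb_comb p
          scaleR_diff_right)
    ultimately have "(2 / s) *\<^sub>R comb ?n y = 0"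
      unfolding eq y_def
      by (simp add: linear_diff[OF linear_comb] linear_scale[OF linear_comb] algebra_simps)
    then have "comb ?n y = 0" using s by simp
    then have "(\<Sum>i\<le>m. (?n i)\<^sup>2) *\<^sub>R y = 0"
      using comb_comb[of ?n y] by (simp add: linear_0[OF linear_comb])
    moreover have "y \<bullet> y = 2 * (1 - \<epsilon> * s)"
      using \<epsilon>\<epsilon> comb_comb[of p x] px
      by (simp add: y_def inner_diff_left inner_diff_right xx comb_sym[of p x "comb p x"] p
          inner_commute[of x "comb p x"] algebra_simps)
    then have "y \<noteq> 0"
      using \<epsilon> s by (auto simp: power2_eq_1_iff)
    ultimately have "(\<Sum>i\<le>m. (?n i)\<^sup>2) = 0" by simp
    then have n: "?n i = 0" if "i \<le> m" for i
      using that by (simp add: sum_nonneg_eq_0_iff)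
    then have "comb ?n x = 0"
      by (simp add: comb_def)
    with eq have "comb p X = \<epsilon> *\<^sub>R X" by simp
    with n Xx show "X \<in> eigen_fibre m A s \<epsilon> x"
      by (simp add: fibre)
  next
    fix X assume X: "X \<in> eigen_fibre m A s \<epsilon> x"
    then have "comb (\<lambda>i. A i x \<bullet> X) x = 0"
      by (simp add: fibre comb_def)
    then show "X \<in> {X \<in> tangent_space ?M x. shape_operator ?M \<eta> x X = \<kappa> *\<^sub>R X}"
      using eigen_fibre_tangent[OF x s \<epsilon> X] shape_iff X by (simp add: fibre)
  qed
qed

end

section \<open>OT-FKM hypersurfaces\<close>

lemma clifford_system_family:
  assumes "clifford_system m P"
  shows "clifford_family m (\<lambda>i. (*v) (P i))"
proof (rule clifford_family.intro)
  show "linear ((*v) (P i))" for i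
    by (rule matrix_vector_mul_linear)
  show "(P i *v x) \<bullet> y = x \<bullet> (P i *v y)" if "i \<le> m" for i x y
    using assms that dot_lmul_matrix[of x "P i" y] transpose_matrix_vector[of "P i" x]
    by (simp add: clifford_system_def)
  show "P i *v (P j *v x) + P j *v (P i *v x) = (if i = j then 2 else 0) *\<^sub>R x"
    if "i \<le> m" "j \<le> m" for i j x
  proof -
    have "P i ** P j + P j ** P i = (if i = j then 2 else 0) *\<^sub>R mat 1"
      using assms that by (simp add: clifford_system_def)
    then have "(P i ** P j + P j ** P i) *v x = ((if i = j then 2 else 0) *\<^sub>R mat 1) *v x"
      by (rule arg_cong)
    then show ?thesis
      by (simp add: matrix_vector_mult_add_rdistrib matrix_vector_mul_assoc
          scaleR_matrix_vector_assoc[symmetric])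
  qed
qed

lemma fkm_hypersurface_eq_level_set:
  "fkm_hypersurface m P \<theta> = level_set m (\<lambda>i. (*v) (P i)) (sin (2 * \<theta>))"
proof -
  have "cos (4 * \<theta>) = 1 - 2 * (sin (2 * \<theta>))\<^sup>2"
    using cos_double_sin[of "2 * \<theta>"] by simp
  then show ?thesis
    by (auto simp: fkm_hypersurface_def level_set_def fkm_poly_def norm_eq_sqrt_inner)
qed

text \<open>With \<open>a = \<theta> + (k - 1) / 4 * pi\<close> both follow from \<open>sin (2 * a) * cot a = 1 + cos (2 * a)\<close>.\<close>

lemma cos_mult_principal_curvature:
  assumes "0 < \<theta>" "\<theta> < pi / 4"
  shows "sin (2 * \<theta>) + cos (2 * \<theta>) * principal_curvature \<theta> 2 = 1"
    and "sin (2 * \<theta>) + cos (2 * \<theta>) * principal_curvature \<theta> 4 = - 1"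
proof -
  have cot: "sin (2 * a) * cot a = 1 + cos (2 * a)" if "sin a \<noteq> 0" for a :: real
    using that by (simp add: sin_double cos_double_cos cot_def power2_eq_square)
  define a where "a = \<theta> + pi / 4"
  have a: "0 < a" "a < pi / 2" using assms by (auto simp: a_def)
  then have nz: "sin a \<noteq> 0" "sin (a + pi / 2) \<noteq> 0"
    using sin_gt_zero[of a] cos_gt_zero[of a] by (auto simp: sin_add)
  have d: "2 * a = 2 * \<theta> + pi / 2" "2 * (a + pi / 2) = 2 * \<theta> + pi / 2 + pi"
    by (simp_all add: a_def)
  have k: "principal_curvature \<theta> 2 = cot a" "principal_curvature \<theta> 4 = cot (a + pi / 2)"
    by (simp_all add: principal_curvature_def a_def algebra_simps)
  show "sin (2 * \<theta>) + cos (2 * \<theta>) * principal_curvature \<theta> 2 = 1"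
    using cot[OF nz(1)] unfolding k d by (simp add: sin_add cos_add)
  show "sin (2 * \<theta>) + cos (2 * \<theta>) * principal_curvature \<theta> 4 = - 1"
    using cot[OF nz(2)] unfolding k d sin_periodic_pi cos_periodic_pi by (simp add: sin_add cos_add)
qed

lemma principal_distribution_eq_eigen_fibre:
  assumes P: "clifford_system m P" and \<theta>: "0 < \<theta>" "\<theta> < pi / 4" and x: "x \<in> fkm_hypersurface m P \<theta>"
    and \<epsilon>: "\<epsilon>\<^sup>2 = 1" and \<kappa>: "sin (2 * \<theta>) + cos (2 * \<theta>) * principal_curvature \<theta> k = \<epsilon>"
  shows "principal_distribution m P \<theta> k x = eigen_fibre m (\<lambda>i. (*v) (P i)) (sin (2 * \<theta>)) \<epsilon> x"
proof -
  interpret clifford_family m "\<lambda>i. (*v) (P i)"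
    by (rule clifford_system_family[OF P])
  let ?A = "\<lambda>i. (*v) (P i)" and ?s = "sin (2 * \<theta>)" and ?c = "cos (2 * \<theta>)"
  have s: "0 < ?s" "?s < 1"
    using \<theta> sin_gt_zero[of "2 * \<theta>"] sin_monotone_2pi[of "2 * \<theta>" "pi / 2"] by auto
  have "0 < ?c" using \<theta> by (intro cos_gt_zero) auto
  then have c: "?c = sqrt (1 - ?s\<^sup>2)"
    by (simp add: cos_squared_eq[symmetric])
  have poly: "fkm_poly m P = (\<lambda>y. norm y ^ 4 - 2 * (\<Sum>i\<le>m. ((P i *v y) \<bullet> y)\<^sup>2))"
    by (simp add: fun_eq_iff fkm_poly_def)
  have normal: "fkm_normal m P y = inverse ?c *\<^sub>R (?s *\<^sub>R y - inverse ?s *\<^sub>R comb (\<lambda>i. ?A i y \<bullet> y) y)"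
    if y: "y \<in> level_set m ?A ?s" for y
  proof -
    have "fkm_normal m P y = inverse (8 * ?s * ?c) *\<^sub>R (8 *\<^sub>R (?s\<^sup>2 *\<^sub>R y - comb (\<lambda>i. ?A i y \<bullet> y) y))"
      unfolding fkm_normal_def poly fkm_gradient[OF y] norm_fkm_gradient[OF y s] c[symmetric] ..
    then show ?thesis
      using s \<open>0 < ?c\<close> by (simp add: scaleR_diff_right power2_eq_square field_simps)
  qed
  show ?thesis
    unfolding principal_distribution_def fkm_hypersurface_eq_level_set
    by (rule principal_space_eq_eigen_fibre[OF _ s \<epsilon> c \<kappa> normal])
       (use x in \<open>simp add: fkm_hypersurface_eq_level_set\<close>)
qed

lemma eigen_fibre_cong:
  assumes "\<And>i. i \<le> n \<Longrightarrow> A i = B i"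
  shows "eigen_fibre n A s \<epsilon> x = eigen_fibre n B s \<epsilon> x"
proof -
  have "(\<Sum>i\<le>n. (A i x \<bullet> x / s) *\<^sub>R A i v) = (\<Sum>i\<le>n. (B i x \<bullet> x / s) *\<^sub>R B i v)" for v
    by (intro sum.cong) (simp_all add: assms)
  then show ?thesis
    by (simp add: eigen_fibre_def pole_def assms)
qed

lemma vector_bundle_isomorphic_cong:
  assumes "\<And>x. x \<in> M \<Longrightarrow> D x = D' x" "\<And>x. x \<in> M \<Longrightarrow> E x = E' x"
  shows "vector_bundle_isomorphic M D E \<longleftrightarrow> vector_bundle_isomorphic M D' E'"
proof -
  have "Sigma M D = Sigma M D'" "Sigma M E = Sigma M E'"
    using assms by (auto intro: Sigma_cong)
  then show ?thesis
    using assms by (simp add: vector_bundle_isomorphic_def)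
qed

theorem corollary2p3:
  fixes P :: "nat \<Rightarrow> real^'n^'n" and l m m1 m2 :: nat and \<theta> :: real
  assumes "CARD('n) = 2 * l"
    and "clifford_system m P"
    and "0 < \<theta>" and "\<theta> < pi / 4"
    and "m1 = m" and "m2 = l - m - 1"
    and "(m1, m2) \<in> {(1, 2), (1, 6), (2, 5), (3, 4)}"
  shows "vector_bundle_isomorphic (fkm_hypersurface m P \<theta>)
           (principal_distribution m P \<theta> 2) (principal_distribution m P \<theta> 4)"
proof -
  let ?A = "\<lambda>i. (*v) (P i)" and ?s = "sin (2 * \<theta>)" and ?M = "fkm_hypersurface m P \<theta>"
  have dim: "DIM(real^'n) = 2 * l" using assms(1) by simp
  have ml: "(m, l) \<in> {(1, 4), (1, 8), (2, 8), (3, 8)}"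
    using assms(5-7) by auto
  interpret small: clifford_family m ?A
    by (rule clifford_system_family[OF assms(2)])
  obtain B where B: "clifford_family l B" and BA: "\<And>i. i \<le> m \<Longrightarrow> B i = ?A i"
    using small.clifford_extension[OF dim ml] by blast
  interpret full: clifford_family l B by (rule B)
  have s: "0 < ?s" "?s < 1"
    using assms(3,4) sin_gt_zero[of "2 * \<theta>"] sin_monotone_2pi[of "2 * \<theta>" "pi / 2"] by auto
  have fibre: "eigen_fibre m B ?s \<epsilon> x = principal_distribution m P \<theta> k x"
    if "x \<in> ?M" "\<epsilon>\<^sup>2 = 1" "?s + cos (2 * \<theta>) * principal_curvature \<theta> k = \<epsilon>" for \<epsilon> k x
    using principal_distribution_eq_eigen_fibre[OF assms(2-4) that] eigen_fibre_cong[of m B ?A, OF BA]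
    by simp
  have "vector_bundle_isomorphic ?M (eigen_fibre m B ?s 1) (eigen_fibre m B ?s (- 1))"
    by (rule full.eigen_fibre_bundles_isomorphic[OF dim _ s])
       (use ml BA in \<open>auto simp: fkm_hypersurface_eq_level_set level_set_def\<close>)
  then show ?thesis
    by (subst (asm) vector_bundle_isomorphic_cong[OF fibre fibre])
       (use cos_mult_principal_curvature[OF assms(3,4)] in auto)
qed

end
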